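(* (1) For every integer $r \geq 3$, $s_{r,r-2}(m)=1$ for all sufficiently large $m$. (2) For every integer $r \geq 3$, $s_{r,r-1}(m)=2$ for all sufficiently large $m$. (3) For every integer $r \geq 3$, $s_{r,r}(m)=\lfloor (m-r+2)/2 \rfloor$ for all sufficiently large $m$. (4) For every integer $r \geq 3$, $s_{r,r+1}(m)=\Theta(m)$. (5) For all integers $r \geq 3$ and $t \geq r+2$, $m^{(t-r+2)/2} \ll s_{r,t}(m) \ll m^{t-r+2}$. (6) For every integer $t \geq 5$, $m^{(t-1)/2} \ll s_{3,t}(m) \ll m^{t-3}$.
   Context: All graphs are finite and simple. For an integer $r\ge 3$, an $r$-system is a pair $(H,\mathcal{F})$ where $H$ is a graph and $\mathcal{F}$ is a family (possibly with repeated members) of subsets of $V(H)$ such that: (i) $H$ contains no $K_r$; (ii) every $S\in\mathcal{F}$ is maximally $K_{r-1}$-free, i.e. $H[S]$ contains no $K_{r-1}$ but $H[S\cup\{v\}]$ contains a $K_{r-1}$ for every vertex $v\notin S$; (iii) for any two distinct members $S\neq T$ of $\mathcal{F}$, $H[S\cap T]$ contains a $K_{r-2}$. For integers $r\ge3$, $t\ge r-2$, an $(r,t)$-system is an $r$-system in which $\mathcal{F}$ has no repeated elements and every set in $\mathcal{F}$ has size exactly $t$. For integers $m\ge 0$, $s_{r,t}(m)$ is the maximum of $|\mathcal{F}|$ over all $(r,t)$-systems $(H,\mathcal{F})$ with $|V(H)|=m$. Notation: $f\ll g$ means $f=O(g)$, and $f=\Theta(g)$ means $f\ll g$ and $g\ll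 f$, as $m\to\infty$ with $r,t$ fixed (constants may depend on $r,t$). *)

theory Defs
  imports Complex_Main "HOL-Library.Multiset" "HOL-Library.Ramsey" "HOL-Library.Landau_Symbols"
begin

text \<open>A graph is given by its vertex set \<open>V\<close> and a set \<open>E\<close> of two-element subsets of \<open>V\<close>.\<close>

definition simple_graph :: "'a set \<Rightarrow> 'a set set \<Rightarrow> bool" where
  "simple_graph V E \<longleftrightarrow> finite V \<and> E \<subseteq> [V]\<^bsup>2\<^esup>"

definition contains_K :: "nat \<Rightarrow> 'a set \<Rightarrow> 'a set set \<Rightarrow> bool" where
  "contains_K k V E \<longleftrightarrow> (\<exists>C \<in> [V]\<^bsup>k\<^esup>. clique C E)"

definition induced_edges :: "'a set set \<Rightarrow> 'a set \<Rightarrow> 'a set set" where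
  "induced_edges E S = {e \<in> E. e \<subseteq> S}"

definition maximally_K_free :: "nat \<Rightarrow> 'a set \<Rightarrow> 'a set set \<Rightarrow> 'a set \<Rightarrow> bool" where
  "maximally_K_free k V E S \<longleftrightarrow>
     \<not> contains_K k S (induced_edges E S) \<and>
     (\<forall>v \<in> V - S. contains_K k (insert v S) (induced_edges E (insert v S)))"

text \<open>The family is a multiset, since members may be repeated.\<close>

definition r_system :: "nat \<Rightarrow> 'a set \<Rightarrow> 'a set set \<Rightarrow> 'a set multiset \<Rightarrow> bool" where
  "r_system r V E F \<longleftrightarrow>
     simple_graph V E \<and>
     (\<forall>S \<in># F. S \<subseteq> V) \<and>
     \<not> contains_K r V E \<and>
     (\<forall>S \<in># F. maximally_K_free (r - 1) V E S) \<and>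
     (\<forall>S \<in># F. \<forall>T \<in># F. S \<noteq> T \<longrightarrow> contains_K (r - 2) (S \<inter> T) (induced_edges E (S \<inter> T)))"

definition rt_system :: "nat \<Rightarrow> nat \<Rightarrow> 'a set \<Rightarrow> 'a set set \<Rightarrow> 'a set multiset \<Rightarrow> bool" where
  "rt_system r t V E F \<longleftrightarrow>
     r_system r V E F \<and> (\<forall>S \<in># F. count F S = 1) \<and> (\<forall>S \<in># F. card S = t)"

text \<open>Every finite graph is isomorphic to one whose vertices are natural numbers, so it suffices
  to let the vertex sets range over \<^typ>\<open>nat set\<close>. The set of sizes is finite and, for \<open>r \<ge> 2\<close>,
  nonempty (see below), so that \<^const>\<open>Max\<close> is the genuine maximum.\<close>

definition system_sizes :: "nat \<Rightarrow> nat \<Rightarrow> nat \<Rightarrow> nat set" where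
  "system_sizes r t m =
     {size F | (V :: nat set) E F. rt_system r t V E F \<and> card V = m}"

definition s :: "nat \<Rightarrow> nat \<Rightarrow> nat \<Rightarrow> nat" where
  "s r t m = Max (system_sizes r t m)"

lemma finite_system_sizes: "finite (system_sizes r t m)"
proof -
  have "size F \<le> 2 ^ m" if F: "rt_system r t V E F" "card V = m" for V :: "nat set" and E F
  proof -
    have V: "finite V" and sub: "set_mset F \<subseteq> Pow V" and one: "\<forall>S \<in># F. count F S = 1"
      using F by (auto simp: rt_system_def r_system_def simple_graph_def)
    have "size F = card (set_mset F)"
      using one by (simp add: size_multiset_overloaded_eq)
    also have "\<dots> \<le> card (Pow V)"
      using V sub by (intro card_mono) auto
    finally show ?thesis
      using V F(2) by (simp add: card_Pow)
  qed
  then have "system_sizes r t m \<subseteq> {..2 ^ m}"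
    by (auto simp: system_sizes_def)
  then show ?thesis
    by (rule finite_subset) simp
qed

lemma system_sizes_nonempty:
  assumes "r \<ge> 2"
  shows "system_sizes r t m \<noteq> {}"
proof -
  have "\<not> contains_K r {..<m} {}"
  proof
    assume "contains_K r {..<m} {}"
    then obtain C where C: "finite C" "card C = r" "clique C ({} :: nat set set)"
      by (auto simp: contains_K_def nsets_def)
    then have "card C \<le> Suc 0"
      by (subst card_le_Suc0_iff_eq) (auto simp: clique_def)
    with C assms show False by simp
  qed
  then have "rt_system r t {..<m} {} {#}"
    by (auto simp: rt_system_def r_system_def simple_graph_def)
  then have "size ({#} :: nat set multiset) \<in> system_sizes r t m"
    unfolding system_sizes_def using card_lessThan by blast
  then show ?thesis by blast
qed

end

theory Submission
  imports Defs "HOL-Library.Discrete_Functions"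
begin

text \<open>Lower bounds: adding a clique on \<open>r - 2\<close> vertices turns the maximal independent \<open>k\<close>-sets of a
  triangle-free graph into an \<open>(r, k + r - 2)\<close>-system; for \<open>k \<ge> 4\<close> a blow-up of the \<open>k\<close>-cycle on
  \<open>k q\<^sup>2\<close> vertices has \<open>q ^ k\<close> such sets.

  Upper bounds: every member meets a fixed one in a clique \<open>K\<close> on \<open>r - 2\<close> vertices, so it suffices to
  count the members containing a given \<open>K\<close>. Classify the other vertices by their non-neighbours in
  \<open>K\<close>. Up to boundedly many choices of a vertex that is adjacent to almost all of its class, the
  remainders \<open>S - K\<close> are, for \<open>t \<le> r + 1\<close>, governed by maximal independent sets in a triangle-free
  class, and a triangle-free graph on \<open>n\<close> vertices has at most \<open>max (n / 2) 10\<close> maximal independent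
  pairs and \<open>O(n ^ (k - 2))\<close> maximal independent \<open>k\<close>-sets for \<open>k \<ge> 3\<close>.\<close>

text \<open>The obstacle for \<open>r > 3\<close> is that a vertex may be kept out of a member
  \<open>S\<close> by a clique mixing several classes, so the trace of \<open>S\<close> on one class
  need not be maximal independent there. What survives is a tightness statement: the blocking clique
  attains equality in Hall's condition for the sets of non-neighbours, and these sets cover that of
  the blocked vertex. When \<open>S - K\<close> has two or three vertices and none of them is
  adjacent to almost all of its class, such cliques are so small that two vertices must miss exactly
  the same single vertex of \<open>K\<close>. For larger \<open>S - K\<close> this control is lost
  and only the trivial exponent \<open>t - (r - 2)\<close> remains, except for \<open>r = 3\<close>,
  where there is just one class.

  The exact value for \<open>t = r\<close> leaves no room for the factor lost in summing over the
  cliques \<open>K\<close>; a family whose members share no such \<open>K\<close> is therefore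
  bounded separately, by a constant.

  In the blow-up, edges compare only neighbouring positions, so each vertex must carry two
  consecutive coordinates of a word of length \<open>k\<close>. This costs \<open>q\<^sup>2\<close>
  vertices per position while only \<open>q\<close> values per position are gained, hence half of
  \<open>k\<close> in the exponent.\<close>

lemma contains_K_iff: "contains_K k S E \<longleftrightarrow> (\<exists>C\<subseteq>S. finite C \<and> card C = k \<and> clique C E)"
  by (auto simp: contains_K_def nsets_def)

lemma contains_K_induced [simp]: "contains_K k S (induced_edges E S) \<longleftrightarrow> contains_K k S E"
proof -
  have "clique C (induced_edges E S) \<longleftrightarrow> clique C E" if "C \<subseteq> S" for C
    using that by (auto simp: clique_def induced_edges_def)
  then show ?thesis
    unfolding contains_K_iff by blast
qed

lemma contains_K_if_clique:
  assumes "C \<subseteq> S" "finite C" "clique C E" "k \<le> card C"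
  shows "contains_K k S E"
proof -
  obtain D where D: "D \<subseteq> C" "card D = k" "finite D"
    using obtain_subset_with_card_n[OF assms(4)] by metis
  then have "D \<subseteq> S" "clique D E"
    using assms by (auto simp: clique_def)
  with D show ?thesis
    unfolding contains_K_iff by blast
qed

lemma card_le_card_index_times:
  assumes "finite I" "G \<subseteq> (\<Union>i\<in>I. A i)" "\<And>i. i \<in> I \<Longrightarrow> finite (A i)" "\<And>i. i \<in> I \<Longrightarrow> card (A i) \<le> c"
  shows "card G \<le> card I * c"
proof -
  have "card G \<le> card (\<Union>i\<in>I. A i)"
    using assms by (intro card_mono) auto
  also have "\<dots> \<le> (\<Sum>i\<in>I. card (A i))"
    by (rule card_UN_le[OF assms(1)])
  also have "\<dots> \<le> card I * c"
    using sum_bounded_above[of I "\<lambda>i. card (A i)" c] assms(4) by simp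
  finally show ?thesis .
qed

lemma card_nsets_le_power: "finite A \<Longrightarrow> card (nsets A k) \<le> card A ^ k"
  by (cases "k \<le> card A") (auto simp: binomial_le_pow binomial_eq_0)

section \<open>Maximal independent sets in triangle-free graphs\<close>

definition triangle_free :: "'a set \<Rightarrow> 'a set set \<Rightarrow> bool" where
  "triangle_free W E \<longleftrightarrow>
     (\<forall>x\<in>W. \<forall>y\<in>W. \<forall>z\<in>W. \<not> ({x, y} \<in> E \<and> {y, z} \<in> E \<and> {x, z} \<in> E))"

definition max_indep :: "'a set \<Rightarrow> 'a set set \<Rightarrow> 'a set \<Rightarrow> bool" where
  "max_indep W E S \<longleftrightarrow>
     S \<subseteq> W \<and> (\<forall>x\<in>S. \<forall>y\<in>S. {x, y} \<notin> E) \<and> (\<forall>v\<in>W - S. \<exists>s\<in>S. {v, s} \<in> E)"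

lemma max_indep_subset: "max_indep W E S \<Longrightarrow> S \<subseteq> W"
  by (simp add: max_indep_def)

lemma max_indep_not_adj: "\<lbrakk>max_indep W E S; x \<in> S; y \<in> S\<rbrakk> \<Longrightarrow> {x, y} \<notin> E"
  by (simp add: max_indep_def)

lemma max_indep_dominates:
  "\<lbrakk>max_indep W E S; v \<in> W; v \<notin> S\<rbrakk> \<Longrightarrow> \<exists>s\<in>S. {v, s} \<in> E"
  by (simp add: max_indep_def)

locale triangle_free_graph =
  fixes W :: "'a set" and E :: "'a set set"
  assumes finite_W: "finite W" and triangle_free: "triangle_free W E"
begin

lemma no_triangle:
  "\<lbrakk>x \<in> W; y \<in> W; z \<in> W; {x, y} \<in> E; {y, z} \<in> E\<rbrakk> \<Longrightarrow> {x, z} \<notin> E"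
  using triangle_free unfolding triangle_free_def by blast

lemma finite_max_indep [simp]: "finite {S. max_indep W E S \<and> P S}"
  by (rule finite_subset[of _ "Pow W"]) (auto simp: max_indep_def finite_W)

text \<open>Two vertices \<open>a\<close>, \<open>b\<close> that both complete \<open>Q\<close> are
  adjacent: \<open>b\<close> has a neighbour in \<open>insert a Q\<close>, and it has none in
  \<open>Q\<close>. So the completions form a clique, which in a triangle-free graph has at most two
  vertices.\<close>

lemma card_max_indep_extensions:
  "card {S. max_indep W E S \<and> Q \<subseteq> S \<and> card S = Suc (card Q)} \<le> 2"
proof -
  let ?X = "{S. max_indep W E S \<and> Q \<subseteq> S \<and> card S = Suc (card Q)}"
  define U where "U = {a. a \<notin> Q \<and> max_indep W E (insert a Q)}"
  have UW: "U \<subseteq> W"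
    by (auto simp: U_def max_indep_def)
  have adj: "{a, b} \<in> E" if ab: "a \<in> U" "b \<in> U" "a \<noteq> b" for a b
  proof -
    have "b \<in> W - insert a Q"
      using ab UW by (auto simp: U_def)
    then obtain s where s: "s \<in> insert a Q" "{b, s} \<in> E"
      using ab(1) max_indep_dominates[of W E "insert a Q" b] by (auto simp: U_def)
    moreover have "{b, s} \<notin> E" if "s \<in> Q"
      using \<open>b \<in> U\<close> that max_indep_not_adj[of W E "insert b Q" b s] by (simp add: U_def)
    ultimately have "s = a" by blast
    with s show ?thesis
      by (simp add: insert_commute)
  qed
  have U2: "card U \<le> 2"
  proof (rule ccontr)
    assume "\<not> card U \<le> 2"
    then have "3 \<le> card U" by linarith
    then obtain D where D: "D \<subseteq> U" "card D = 3"
      by (rule obtain_subset_with_card_n)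
    then obtain a b c where "D = {a, b, c}" "a \<noteq> b" "b \<noteq> c" "a \<noteq> c"
      unfolding card_3_iff by blast
    with D have "{a, b} \<in> E" "{b, c} \<in> E" "{a, c} \<in> E" "a \<in> W" "b \<in> W" "c \<in> W"
      using adj UW by auto
    then show False
      using no_triangle by blast
  qed
  have "?X \<subseteq> (\<lambda>a. insert a Q) ` U"
  proof
    fix S assume S: "S \<in> ?X"
    then have "finite S"
      using finite_W finite_subset unfolding max_indep_def by blast
    moreover have "finite Q"
      using S \<open>finite S\<close> finite_subset by blast
    ultimately have "card (S - Q) = 1"
      using S by (simp add: card_Diff_subset)
    then obtain a where "S - Q = {a}"
      by (auto simp: card_1_singleton_iff)
    with S have "S = insert a Q" "a \<notin> Q"
      by auto
    with S show "S \<in> (\<lambda>a. insert a Q) ` U"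
      by (simp add: U_def)
  qed
  moreover have "finite U"
    using UW finite_W finite_subset by blast
  ultimately have "card ?X \<le> card U"
    by (rule surj_card_le[rotated])
  with U2 show ?thesis by linarith
qed

section \<open>Maximal independent pairs\<close>

lemma card_max_indep_pairs_through: "card {S. max_indep W E S \<and> x \<in> S \<and> card S = 2} \<le> 2"
  using card_max_indep_extensions[of "{x}"] by (simp add: numeral_2_eq_2)

lemma card_max_indep_pairs_meeting:
  assumes "finite X"
  shows "card {S. max_indep W E S \<and> card S = 2 \<and> S \<inter> X \<noteq> {}} \<le> card X * 2"
  by (rule card_le_card_index_times[where A = "\<lambda>x. {S. max_indep W E S \<and> x \<in> S \<and> card S = 2}"])
     (use assms card_max_indep_pairs_through in auto)

lemma card_max_indep_pairs_le: "card {S. max_indep W E S \<and> card S = 2} \<le> 2 * card W"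
proof -
  have "{S. max_indep W E S \<and> card S = 2} = {S. max_indep W E S \<and> card S = 2 \<and> S \<inter> W \<noteq> {}}"
    unfolding max_indep_def by (auto simp: Int_absorb2)
  then show ?thesis
    using card_max_indep_pairs_meeting[OF finite_W] by simp
qed

text \<open>Disjoint pairs give the half. If \<open>{x, y}\<close> and \<open>{x, z}\<close> are
  both maximal independent, then \<open>y\<close> and \<open>z\<close> are adjacent, so no other
  vertex sees both of them and every other vertex must see \<open>x\<close>. A pair \<open>D\<close>
  avoiding \<open>x\<close>, \<open>y\<close>, \<open>z\<close> then leaves no room for a sixth
  vertex, since that vertex, a neighbour of it in \<open>D\<close> and \<open>x\<close> would form a
  triangle. Hence either all pairs meet \<open>{x, y, z}\<close>, giving at most 6, or there are at
  most 5 vertices, giving at most 10.\<close>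

lemma card_max_indep_pairs:
  "2 * card {S. max_indep W E S \<and> card S = 2} \<le> card W \<or> card {S. max_indep W E S \<and> card S = 2} \<le> 10"
proof -
  let ?P = "{S. max_indep W E S \<and> card S = 2}"
  have finP: "finite ?P" by simp
  show ?thesis
  proof (cases "pairwise disjnt ?P")
    case True
    have "card (\<Union>?P) = (\<Sum>S\<in>?P. card S)"
      using True by (intro card_Union_disjoint) (auto simp: card_2_iff)
    also have "\<dots> = 2 * card ?P"
      by simp
    finally show ?thesis
      using card_mono[OF finite_W, of "\<Union>?P"] by (auto simp: max_indep_def)
  next
    case False
    then obtain S T x where ST: "S \<in> ?P" "T \<in> ?P" "S \<noteq> T" "x \<in> S" "x \<in> T"
      by (auto simp: pairwise_def disjnt_def)
    obtain y where S: "S = {x, y}" "x \<noteq> y"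
      using ST by (auto simp: card_2_iff)
    obtain z where T: "T = {x, z}" "x \<noteq> z"
      using ST by (auto simp: card_2_iff)
    have yz: "y \<noteq> z" using S T ST by auto
    have W: "x \<in> W" "y \<in> W" "z \<in> W"
      using ST S T by (auto simp: max_indep_def)
    have ind: "{x, y} \<notin> E" "{x, z} \<notin> E" and
      domS: "\<And>v. v \<in> W \<Longrightarrow> v \<noteq> x \<Longrightarrow> v \<noteq> y \<Longrightarrow> {v, x} \<in> E \<or> {v, y} \<in> E" and
      domT: "\<And>v. v \<in> W \<Longrightarrow> v \<noteq> x \<Longrightarrow> v \<noteq> z \<Longrightarrow> {v, x} \<in> E \<or> {v, z} \<in> E"
      using ST S T by (auto simp: max_indep_def)
    have "{y, z} \<in> E"
      using domT[of y] W ind yz S by (auto simp: insert_commute)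
    then have xall: "{v, x} \<in> E" if "v \<in> W - {x, y, z}" for v
      using domS[of v] domT[of v] no_triangle[of y z v] that W
      by (auto simp: insert_commute)
    show ?thesis
    proof (cases "?P \<subseteq> {S. max_indep W E S \<and> card S = 2 \<and> S \<inter> {x, y, z} \<noteq> {}}")
      case True
      then have "card ?P \<le> card {S. max_indep W E S \<and> card S = 2 \<and> S \<inter> {x, y, z} \<noteq> {}}"
        by (intro card_mono) auto
      also have "\<dots> \<le> card {x, y, z} * 2"
        by (rule card_max_indep_pairs_meeting) simp
      also have "\<dots> \<le> 6"
        by (simp add: card_insert_if)
      finally show ?thesis by simp
    next
      case False
      then obtain D where D: "max_indep W E D" "card D = 2" "D \<inter> {x, y, z} = {}"
        by auto
      then obtain u v where uv: "D = {u, v}"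
        by (auto simp: card_2_iff)
      have "W \<subseteq> {x, y, z, u, v}"
      proof (rule ccontr)
        assume "\<not> ?thesis"
        then obtain w where w: "w \<in> W" "w \<notin> {x, y, z, u, v}" by auto
        have uvW: "u \<in> W - {x, y, z}" "v \<in> W - {x, y, z}"
          using D uv by (auto simp: max_indep_def)
        have "{w, u} \<in> E \<or> {w, v} \<in> E"
          using D uv w by (auto simp: max_indep_def)
        then show False
          using xall[of w] xall[of u] xall[of v] uvW w no_triangle[of w u x] no_triangle[of w v x] W
          by auto
      qed
      then have "card W \<le> card {x, y, z, u, v}"
        by (intro card_mono) auto
      also have "\<dots> \<le> 5"
        by (simp add: card_insert_if)
      finally show ?thesis
        using card_max_indep_pairs_le by linarith
    qed
  qed
qed

section \<open>Maximal independent sets with at least three vertices\<close>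

text \<open>Each \<open>e\<close> in \<open>B - Q\<close> lies in at most two of the counted sets,
  because only one vertex is then missing. More than \<open>2 * card B\<close> sets therefore leave
  one that avoids \<open>B\<close> outside \<open>Q\<close>.\<close>

lemma max_indep_avoiding:
  assumes Q: "card Q + 2 = k" and B: "finite B"
    and heavy: "2 * card B < card {S. max_indep W E S \<and> card S = k \<and> Q \<subseteq> S}"
  obtains u w where "max_indep W E (insert u (insert w Q))" "u \<notin> Q" "w \<notin> Q" "u \<notin> B" "w \<notin> B"
proof -
  let ?M = "{S. max_indep W E S \<and> card S = k \<and> Q \<subseteq> S}"
  let ?A = "\<lambda>e. {S. max_indep W E S \<and> insert e Q \<subseteq> S \<and> card S = k}"
  have finQ: "finite Q"
  proof (rule ccontr)
    assume "infinite Q"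
    have "\<not> Q \<subseteq> S" if "max_indep W E S" for S
      using \<open>infinite Q\<close> finite_subset[OF _ finite_W] max_indep_subset[OF that] by auto
    then have "?M = {}"
      by auto
    with heavy show False by simp
  qed
  have "\<not> ?M \<subseteq> (\<Union>e\<in>B - Q. ?A e)"
  proof
    assume "?M \<subseteq> (\<Union>e\<in>B - Q. ?A e)"
    then have "card ?M \<le> card (B - Q) * 2"
    proof (rule card_le_card_index_times[rotated])
      fix e assume "e \<in> B - Q"
      then have "Suc (card (insert e Q)) = k"
        using Q finQ by simp
      then show "card (?A e) \<le> 2"
        using card_max_indep_extensions[of "insert e Q"] by simp
    qed (use B in auto)
    also have "\<dots> \<le> 2 * card B"
      using card_mono[OF B, of "B - Q"] by auto
    finally show False using heavy by simp
  qed
  then obtain S where "S \<in> ?M" "S \<notin> (\<Union>e\<in>B - Q. ?A e)"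
    unfolding subset_iff not_all not_imp by (elim exE conjE)
  then have S: "max_indep W E S" "card S = k" "Q \<subseteq> S" "S \<inter> (B - Q) = {}"
    by auto
  have "card (S - Q) = 2"
    using S Q finQ by (simp add: card_Diff_subset)
  then obtain u w where "S - Q = {u, w}"
    by (auto simp: card_2_iff)
  with S(3) have "S = insert u (insert w Q)" "u \<notin> Q" "w \<notin> Q"
    by auto
  with S show ?thesis
    by (intro that[of u w]) auto
qed

text \<open>Exchanging \<open>y\<close>, \<open>z\<close> for a fresh pair \<open>u\<close>,
  \<open>w\<close> leaves, between the two pairs, at least one edge at each of the four vertices. If
  \<open>u\<close> or \<open>w\<close> saw both \<open>y\<close> and \<open>z\<close>, it could see
  no vertex of a further fresh pair, each of which sees \<open>y\<close> or \<open>z\<close>, and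
  the set containing that further pair would fail to dominate it. So the edges between the pairs
  form a perfect matching. The threshold 8 is twice 4, the largest number of vertices that a fresh
  pair has to avoid.\<close>

lemma max_indep_heavy_crossing_pair:
  assumes S: "max_indep W E (insert x (insert y (insert z R)))"
    and yz: "y \<notin> insert x R" "z \<notin> insert x R"
    and card: "card (insert x R) + 2 = k"
    and heavy: "8 < card {S. max_indep W E S \<and> card S = k \<and> insert x R \<subseteq> S}"
    and B: "finite B" "card B \<le> 2"
  obtains a b where "max_indep W E (insert a (insert b (insert x R)))" "a \<notin> B" "b \<notin> B"
    "{a, z} \<in> E" "{b, y} \<in> E" "{a, y} \<notin> E" "{b, z} \<notin> E"
proof -
  let ?S = "insert x (insert y (insert z R))"
  have avoid: "\<exists>u w. max_indep W E (insert u (insert w (insert x R))) \<and>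
      u \<notin> insert x R \<and> w \<notin> insert x R \<and> u \<notin> D \<and> w \<notin> D"
    if D: "finite D" "card D \<le> 4" for D
    using max_indep_avoiding[OF card D(1)] D(2) heavy
    by (metis (no_types, lifting) le_less_trans mult_le_mono2 mult_2 numeral_Bit0)
  have "card ({y, z} \<union> B) \<le> card {y, z} + card B"
    by (rule card_Un_le)
  also have "\<dots> \<le> 4"
    using B card_insert_le_m1[of 2 "{z}" y] by simp
  finally obtain u w where uw: "max_indep W E (insert u (insert w (insert x R)))"
      "u \<notin> insert x R" "w \<notin> insert x R" "u \<notin> {y, z} \<union> B" "w \<notin> {y, z} \<union> B"
    using avoid[of "{y, z} \<union> B"] B by auto
  let ?T = "insert u (insert w (insert x R))"
  have W: "x \<in> W" "y \<in> W" "z \<in> W" "u \<in> W" "w \<in> W"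
    using max_indep_subset[OF S] max_indep_subset[OF uw(1)] by auto
  have dom: "{v, y} \<in> E \<or> {v, z} \<in> E"
    if T: "max_indep W E T" "insert x R \<subseteq> T" "v \<in> T" "v \<notin> ?S" for v T
  proof -
    have "v \<in> W" using max_indep_subset[OF T(1)] T(3) by blast
    then obtain s where s: "s \<in> ?S" "{v, s} \<in> E"
      using max_indep_dominates[OF S] T(4) by blast
    moreover have "s \<notin> insert x R"
      using max_indep_not_adj[OF T(1) T(3)] s T(2) by blast
    ultimately show ?thesis by auto
  qed
  have domT: "{v, u} \<in> E \<or> {v, w} \<in> E" if v: "v \<in> ?S" "v \<notin> ?T" for v
  proof -
    have "v \<in> W" using max_indep_subset[OF S] v(1) by blast
    then obtain s where s: "s \<in> ?T" "{v, s} \<in> E"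
      using max_indep_dominates[OF uw(1)] v(2) by blast
    moreover have "s \<notin> insert x R"
      using max_indep_not_adj[OF S v(1)] s by blast
    ultimately show ?thesis by auto
  qed
  have not_both: "\<not> ({v, y} \<in> E \<and> {v, z} \<in> E)" if v: "v \<in> {u, w}" for v
  proof
    assume vyz: "{v, y} \<in> E \<and> {v, z} \<in> E"
    have "card {y, z, u, w} \<le> 4"
      by (simp add: card_insert_if)
    then obtain u' w' where uw': "max_indep W E (insert u' (insert w' (insert x R)))"
      "u' \<notin> insert x R" "w' \<notin> insert x R" "u' \<notin> {y, z, u, w}" "w' \<notin> {y, z, u, w}"
      using avoid[of "{y, z, u, w}"] by auto
    have W': "u' \<in> W" "w' \<in> W" "v \<in> W"
      using max_indep_subset[OF uw'(1)] W v by auto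
    have na: "{v, v'} \<notin> E" if v': "v' \<in> {u', w'}" for v'
    proof -
      have "{v', y} \<in> E \<or> {v', z} \<in> E"
        using dom[OF uw'(1), of v'] v' uw' by auto
      then show ?thesis
        using no_triangle[of v' y v] no_triangle[of v' z v] vyz W W' v'
        by (auto simp: insert_commute)
    qed
    obtain s where s: "s \<in> insert u' (insert w' (insert x R))" "{v, s} \<in> E"
      using max_indep_dominates[OF uw'(1) W'(3)] uw uw' v by auto
    then have "s \<in> insert x R"
      using na by auto
    then show False
      using max_indep_not_adj[OF uw(1), of v s] v s(2) by auto
  qed
  have nxR: "u \<notin> ?S" "w \<notin> ?S" using uw by auto
  have uyz: "{u, y} \<in> E \<or> {u, z} \<in> E" and wyz: "{w, y} \<in> E \<or> {w, z} \<in> E"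
    using dom[OF uw(1)] nxR by blast+
  have "{y, u} \<in> E \<or> {y, w} \<in> E" "{z, u} \<in> E \<or> {z, w} \<in> E"
    using domT[of y] domT[of z] yz uw by auto
  then consider "{u, z} \<in> E" "{w, y} \<in> E" "{u, y} \<notin> E" "{w, z} \<notin> E"
    | "{w, z} \<in> E" "{u, y} \<in> E" "{w, y} \<notin> E" "{u, z} \<notin> E"
    using not_both[of u] not_both[of w] uyz wyz by (auto simp: insert_commute)
  then show ?thesis
  proof cases
    case 1
    then show ?thesis using that[of u w] uw by simp
  next
    case 2
    then show ?thesis using that[of w u] uw by (simp add: insert_commute)
  qed
qed

text \<open>If all three \<open>(k - 2)\<close>-subsets \<open>insert x R\<close>, \<open>insert y R\<close>, \<open>insert z R\<close> lay in many maximal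
  independent sets, one crossing pair from each of them would produce a triangle.\<close>

lemma max_indep_light_subset:
  assumes S: "max_indep W E S" and k: "card S = k" "k \<ge> 3"
  shows "\<exists>Q\<subseteq>S. card Q = k - 2 \<and> card {T. max_indep W E T \<and> card T = k \<and> Q \<subseteq> T} \<le> 8"
proof (rule ccontr)
  assume neg: "\<not> ?thesis"
  have finS: "finite S"
    using k by (intro card_ge_0_finite) simp
  obtain D where D: "D \<subseteq> S" "card D = 3"
    using obtain_subset_with_card_n k by metis
  then obtain x y z where xyz: "D = {x, y, z}" "x \<noteq> y" "x \<noteq> z" "y \<noteq> z"
    unfolding card_3_iff by blast
  define R where "R = S - D"
  have finR: "finite R" and cR: "card R = k - 3"
    using finS D k unfolding R_def by (auto simp: card_Diff_subset finite_subset)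
  have nR: "x \<notin> R" "y \<notin> R" "z \<notin> R"
    by (auto simp: R_def xyz)
  have S_eq: "S = insert x (insert y (insert z R))"
    using D by (auto simp: R_def xyz)
  have heavy: "8 < card {T. max_indep W E T \<and> card T = k \<and> insert v R \<subseteq> T}"
    and card: "card (insert v R) + 2 = k" if v: "v \<in> {x, y, z}" for v
  proof -
    have "card (insert v R) = k - 2" "insert v R \<subseteq> S"
      using v nR finR cR k S_eq by auto
    then show "8 < card {T. max_indep W E T \<and> card T = k \<and> insert v R \<subseteq> T}"
      "card (insert v R) + 2 = k"
      using neg k by (auto simp: not_le)
  qed
  have Sx: "max_indep W E (insert x (insert y (insert z R)))"
    and Sy: "max_indep W E (insert y (insert x (insert z R)))"
    and Sz: "max_indep W E (insert z (insert x (insert y R)))"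
    using S by (simp_all add: S_eq insert_commute)
  \<comment> \<open>Letters record the neighbour in \<open>S\<close>: \<open>a\<close>,
    \<open>a'\<close> see \<open>z\<close>; \<open>b\<close>, \<open>b''\<close> see
    \<open>y\<close>; \<open>c'\<close>, \<open>c''\<close> see \<open>x\<close>. The triangle will
    be \<open>a'\<close>, \<open>b\<close>, \<open>c''\<close>, one vertex from each exchange. Two
    vertices with the same letter share a neighbour, so they are not adjacent; choosing them
    distinct ensures that each corner of the triangle lies outside the set that has to dominate
    it.\<close>
  obtain a' c' where Y: "max_indep W E (insert a' (insert c' (insert y R)))"
    "{a', z} \<in> E" "{c', x} \<in> E" "{a', x} \<notin> E" "{c', z} \<notin> E"
    by (rule max_indep_heavy_crossing_pair[OF Sy _ _ card heavy, of "{}"]) (use nR xyz in auto)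
  obtain a b where X: "max_indep W E (insert a (insert b (insert x R)))"
    "{a, z} \<in> E" "{b, y} \<in> E" "{a, y} \<notin> E" "{b, z} \<notin> E" "a \<noteq> a'"
    by (rule max_indep_heavy_crossing_pair[OF Sx _ _ card heavy, of "{a'}"]) (use nR xyz in auto)
  obtain b'' c'' where Z: "max_indep W E (insert b'' (insert c'' (insert z R)))"
    "{b'', y} \<in> E" "{c'', x} \<in> E" "{b'', x} \<notin> E" "{c'', y} \<notin> E" "b'' \<noteq> b" "c'' \<noteq> c'"
    by (rule max_indep_heavy_crossing_pair[OF Sz _ _ card heavy, of "{b, c'}"])
       (use nR xyz in \<open>auto simp: card_insert_if\<close>)
  have W: "x \<in> W" "y \<in> W" "z \<in> W" "a' \<in> W" "c' \<in> W" "a \<in> W" "b \<in> W" "b'' \<in> W" "c'' \<in> W"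
    using max_indep_subset[OF Sx] max_indep_subset[OF X(1)] max_indep_subset[OF Y(1)]
      max_indep_subset[OF Z(1)] by auto
  have nS: "{v, w} \<notin> E" if "v \<in> S" "w \<in> S" for v w
    using max_indep_not_adj[OF S] that .
  have c''R: "c'' \<notin> R" and a'R: "a' \<notin> R" and bR: "b \<notin> R"
    using nS[of c'' x] nS[of a' z] nS[of b y] X Y Z S_eq by auto
  \<comment> \<open>The set of \<open>Y\<close> must dominate \<open>c''\<close>. Its vertices in
    \<open>R\<close> and \<open>y\<close> are not adjacent to \<open>c''\<close>, and
    \<open>c'\<close> shares the neighbour \<open>x\<close> with it, so only \<open>a'\<close> is
    left. The other two edges arise in the same way.\<close>
  have "{a', c''} \<in> E"
  proof -
    have "c'' \<notin> insert a' (insert c' (insert y R))"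
      using Y Z c''R nS[of y x] S_eq by auto
    then obtain s where s: "s \<in> insert a' (insert c' (insert y R))" "{c'', s} \<in> E"
      using max_indep_dominates[OF Y(1) W(9)] by blast
    have "s \<notin> R" using max_indep_not_adj[OF Z(1), of c'' s] s by auto
    moreover have "s \<noteq> y" using s Z by auto
    moreover have "s \<noteq> c'"
      using s Y Z no_triangle[of c'' c' x] W by auto
    ultimately show ?thesis using s by (auto simp: insert_commute)
  qed
  moreover have "{a', b} \<in> E"
  proof -
    have "a' \<notin> insert a (insert b (insert x R))"
      using X Y a'R nS[of x z] S_eq by auto
    then obtain s where s: "s \<in> insert a (insert b (insert x R))" "{a', s} \<in> E"
      using max_indep_dominates[OF X(1) W(4)] by blast
    have "s \<notin> R" using max_indep_not_adj[OF Y(1), of a' s] s by auto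
    moreover have "s \<noteq> x" using s Y by auto
    moreover have "s \<noteq> a"
      using s X Y no_triangle[of a' a z] W by auto
    ultimately show ?thesis using s by auto
  qed
  moreover have "{b, c''} \<in> E"
  proof -
    have "b \<notin> insert b'' (insert c'' (insert z R))"
      using X Z bR nS[of z y] S_eq by auto
    then obtain s where s: "s \<in> insert b'' (insert c'' (insert z R))" "{b, s} \<in> E"
      using max_indep_dominates[OF Z(1) W(7)] by blast
    have "s \<notin> R" using max_indep_not_adj[OF X(1), of b s] s by auto
    moreover have "s \<noteq> z" using s X by auto
    moreover have "s \<noteq> b''"
      using s X Z no_triangle[of b b'' y] W by auto
    ultimately show ?thesis using s by auto
  qed
  ultimately show False
    using no_triangle[of a' b c''] W by blast
qed

text \<open>Every set is charged to one of its \<open>(k - 2)\<close>-subsets that lies in at most 8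
  sets.\<close>

lemma card_max_indep_le:
  assumes "k \<ge> 3"
  shows "card {S. max_indep W E S \<and> card S = k} \<le> card W ^ (k - 2) * 8"
proof -
  define I where "I = {Q \<in> [W]\<^bsup>(k - 2)\<^esup>. card {T. max_indep W E T \<and> card T = k \<and> Q \<subseteq> T} \<le> 8}"
  have "card {S. max_indep W E S \<and> card S = k} \<le> card I * 8"
  proof (rule card_le_card_index_times[where A = "\<lambda>Q. {T. max_indep W E T \<and> card T = k \<and> Q \<subseteq> T}"])
    show "{S. max_indep W E S \<and> card S = k} \<subseteq> (\<Union>Q\<in>I. {T. max_indep W E T \<and> card T = k \<and> Q \<subseteq> T})"
    proof
      fix S assume "S \<in> {S. max_indep W E S \<and> card S = k}"
      then have S: "max_indep W E S" "card S = k" by auto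
      then obtain Q where Q: "Q \<subseteq> S" "card Q = k - 2"
        "card {T. max_indep W E T \<and> card T = k \<and> Q \<subseteq> T} \<le> 8"
        using max_indep_light_subset assms by blast
      have "Q \<subseteq> W" using Q(1) max_indep_subset[OF S(1)] by blast
      then have "Q \<in> I"
        using Q finite_subset[OF _ finite_W] by (auto simp: I_def nsets_def)
      with Q S show "S \<in> (\<Union>Q\<in>I. {T. max_indep W E T \<and> card T = k \<and> Q \<subseteq> T})"
        by blast
    qed
  qed (auto simp: I_def finite_imp_finite_nsets finite_W)
  also have "card I \<le> card ([W]\<^bsup>(k - 2)\<^esup>)"
    by (intro card_mono) (auto simp: I_def finite_imp_finite_nsets finite_W)
  also have "\<dots> \<le> card W ^ (k - 2)"
    by (rule card_nsets_le_power[OF finite_W])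
  finally show ?thesis by simp
qed

end

section \<open>Maximally clique-free sets\<close>

locale clique_free_graph =
  fixes V :: "'a set" and E :: "'a set set" and r :: nat
  assumes simple: "simple_graph V E" and clique_free: "\<not> contains_K r V E" and r: "r \<ge> 3"
begin

lemma finite_V: "finite V"
  using simple by (simp add: simple_graph_def)

lemma no_loop [simp]: "{v} \<notin> E"
  using simple by (auto simp: simple_graph_def nsets_def)

lemma card_clique_less: "\<lbrakk>C \<subseteq> V; clique C E\<rbrakk> \<Longrightarrow> card C < r"
  using contains_K_if_clique[of C V E r] clique_free finite_subset[OF _ finite_V, of C] by linarith

definition sat :: "'a set \<Rightarrow> bool" where
  "sat S \<longleftrightarrow> S \<subseteq> V \<and> maximally_K_free (r - 1) V E S"

lemma finite_sat [simp]: "finite {S. sat S \<and> P S}"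
  by (rule finite_subset[of _ "Pow V"]) (auto simp: sat_def finite_V)

lemma sat_subset: "sat S \<Longrightarrow> S \<subseteq> V"
  by (simp add: sat_def)

lemma sat_finite: "sat S \<Longrightarrow> finite S"
  using sat_subset finite_subset[OF _ finite_V] by blast

lemma sat_card_clique_less: "\<lbrakk>sat S; C \<subseteq> S; clique C E\<rbrakk> \<Longrightarrow> card C < r - 1"
  using contains_K_if_clique[of C S E "r - 1"] sat_finite finite_subset[of C S]
  by (fastforce simp: sat_def maximally_K_free_def)

lemma sat_insert_clique:
  assumes "sat S" "v \<in> V" "v \<notin> S"
  obtains D where "D \<subseteq> insert v S" "finite D" "card D = r - 1" "clique D E" "v \<in> D"
proof -
  have "contains_K (r - 1) (insert v S) E"
    using assms by (simp add: sat_def maximally_K_free_def)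
  then obtain D where D: "D \<subseteq> insert v S" "finite D" "card D = r - 1" "clique D E"
    unfolding contains_K_iff by blast
  moreover have "v \<in> D"
  proof (rule ccontr)
    assume "v \<notin> D"
    then have "D \<subseteq> S" using D(1) by blast
    then show False
      using sat_card_clique_less[OF assms(1) _ D(4)] D(3) by simp
  qed
  ultimately show ?thesis by (rule that)
qed

text \<open>Two completions \<open>a\<close>, \<open>b\<close> of \<open>Q\<close> are adjacent: the
  clique on \<open>r - 1\<close> vertices created by adding \<open>b\<close> to
  \<open>insert a Q\<close> must use both, as neither \<open>insert a Q\<close> nor
  \<open>insert b Q\<close> contains such a clique. So the completions form a clique, and there are
  fewer than \<open>r\<close> of them.\<close>

lemma card_sat_extensions:
  "card {S. sat S \<and> Q \<subseteq> S \<and> card S = Suc (card Q)} \<le> r - 1"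
proof -
  let ?X = "{S. sat S \<and> Q \<subseteq> S \<and> card S = Suc (card Q)}"
  define U where "U = {a. a \<notin> Q \<and> sat (insert a Q)}"
  have UV: "U \<subseteq> V"
    by (auto simp: U_def sat_def)
  have "{a, b} \<in> E" if ab: "a \<in> U" "b \<in> U" "a \<noteq> b" for a b
  proof -
    have "b \<in> V" "b \<notin> insert a Q" "sat (insert a Q)" "sat (insert b Q)"
      using ab UV by (auto simp: U_def)
    then obtain D where D: "D \<subseteq> insert b (insert a Q)" "card D = r - 1" "clique D E" "b \<in> D"
      using sat_insert_clique[of "insert a Q" b] by metis
    have "a \<in> D"
    proof (rule ccontr)
      assume "a \<notin> D"
      then have "D \<subseteq> insert b Q" using D by blast
      then show False
        using sat_card_clique_less[OF \<open>sat (insert b Q)\<close> _ D(3)] D(2) by simp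
    qed
    with D ab show ?thesis by (auto simp: clique_def)
  qed
  then have "card U < r"
    using card_clique_less[OF UV] by (simp add: clique_def)
  moreover have "?X \<subseteq> (\<lambda>a. insert a Q) ` U"
  proof
    fix S assume S: "S \<in> ?X"
    then have "finite S"
      using sat_finite by blast
    moreover have "finite Q"
      using S finite_subset[OF _ \<open>finite S\<close>] by blast
    ultimately have "card (S - Q) = 1"
      using S by (simp add: card_Diff_subset)
    then obtain a where "S - Q = {a}"
      by (auto simp: card_1_singleton_iff)
    with S have "S = insert a Q" "a \<notin> Q"
      by auto
    with S show "S \<in> (\<lambda>a. insert a Q) ` U"
      by (simp add: U_def)
  qed
  moreover have "finite U"
    using UV finite_V finite_subset by blast
  ultimately show ?thesis
    using surj_card_le[of U ?X "\<lambda>a. insert a Q"] r by linarith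
qed

lemma card_sat_extensions2:
  assumes "finite Q"
  shows "card {S. sat S \<and> Q \<subseteq> S \<and> card S = card Q + 2} \<le> card V * (r - 1)"
proof (rule card_le_card_index_times[OF finite_V])
  let ?A = "\<lambda>v. if v \<in> Q then {} else {S. sat S \<and> insert v Q \<subseteq> S \<and> card S = Suc (card (insert v Q))}"
  show "{S. sat S \<and> Q \<subseteq> S \<and> card S = card Q + 2} \<subseteq> (\<Union>v\<in>V. ?A v)"
  proof
    fix S assume "S \<in> {S. sat S \<and> Q \<subseteq> S \<and> card S = card Q + 2}"
    then have S: "sat S" "Q \<subseteq> S" "card S = card Q + 2" by auto
    then have "S \<noteq> Q" by auto
    then obtain v where v: "v \<in> S" "v \<notin> Q" using S(2) by blast
    then have "S \<in> ?A v" "v \<in> V" using S assms sat_subset[OF S(1)] by auto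
    then show "S \<in> (\<Union>v\<in>V. ?A v)" by blast
  qed
  show "card (?A v) \<le> r - 1" for v
    using card_sat_extensions[of "insert v Q"] by auto
qed auto

text \<open>Take a maximal clique inside \<open>U\<close>; it has at most \<open>r - 1\<close>
  vertices. A vertex of \<open>U\<close> outside all their exceptional sets would extend it. Since
  there are no loops, every vertex belongs to its own exceptional set.\<close>

lemma card_almost_clique:
  assumes U: "U \<subseteq> V" and ex: "\<And>u. u \<in> U \<Longrightarrow> \<exists>S. finite S \<and> card S \<le> t \<and> (\<forall>v\<in>U - S. {u, v} \<in> E)"
  shows "card U \<le> (r - 1) * t"
proof -
  obtain f where f: "\<And>u. u \<in> U \<Longrightarrow> finite (f u) \<and> card (f u) \<le> t \<and> (\<forall>v\<in>U - f u. {u, v} \<in> E)"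
    using ex by metis
  let ?CC = "{C. C \<subseteq> U \<and> clique C E}"
  have finU: "finite U" using U finite_V finite_subset by blast
  then have "finite ?CC" by simp
  moreover have "{} \<in> ?CC" by (simp add: clique_def)
  then have "?CC \<noteq> {}" by blast
  ultimately obtain C where C: "C \<in> ?CC" and max: "\<forall>D\<in>?CC. C \<subseteq> D \<longrightarrow> C = D"
    by (rule finite_has_maximal[elim_format]) (elim bexE)
  have CU: "C \<subseteq> U" "clique C E" using C by auto
  have finC: "finite C" using CU finU finite_subset by blast
  have "U \<subseteq> (\<Union>c\<in>C. f c)"
  proof
    fix u assume u: "u \<in> U"
    show "u \<in> (\<Union>c\<in>C. f c)"
    proof (rule ccontr)
      assume nu: "u \<notin> (\<Union>c\<in>C. f c)"
      then have adj: "{c, u} \<in> E" if "c \<in> C" for c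
        using f[of c] that CU u by blast
      then have "clique (insert u C) E"
        using CU by (auto simp: clique_def insert_commute)
      then have "insert u C \<in> ?CC"
        using CU u by blast
      then have "C = insert u C"
        using max by blast
      then have "u \<in> C" by blast
      then show False using adj[of u] by simp
    qed
  qed
  then have "card U \<le> card C * t"
    by (rule card_le_card_index_times[OF finC]) (use f CU in auto)
  moreover have "card C \<le> r - 1"
    using card_clique_less[of C] CU U by fastforce
  ultimately show ?thesis
    using mult_le_mono1 order.trans by blast
qed

end

text \<open>Once a clique \<open>K\<close> on \<open>r - 2\<close> vertices is fixed, only the sets \<open>M v\<close> of non-neighbours in \<open>K\<close>
  and the edges outside \<open>K\<close> matter: \<open>S \<supseteq> K\<close> is \<open>K\<^bsub>r-1\<^esub>\<close>-free iff all cliques \<open>C \<subseteq> S - K\<close> satisfy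
  Hall's condition \<open>card C \<le> card (\<Union>(M ` C))\<close>.\<close>

locale rooted_graph = clique_free_graph +
  fixes K :: "'a set"
  assumes K: "K \<subseteq> V" "clique K E" "card K = r - 2"
begin

definition M :: "'a \<Rightarrow> 'a set" where
  "M v = {k \<in> K. {k, v} \<notin> E}"

text \<open>A vertex outside \<open>K\<close> that sees all of \<open>K\<close> forms a clique on
  \<open>r - 1\<close> vertices with it, so no member containing \<open>K\<close> can contain it.
  What remains are the candidates for \<open>S - K\<close>.\<close>

definition W :: "'a set" where
  "W = {v \<in> V - K. M v \<noteq> {}}"

definition cls :: "'a set \<Rightarrow> 'a set" where
  "cls A = {v \<in> W. M v = A}"

lemma finite_K: "finite K"
  using K finite_V finite_subset by blast

lemma M_subset: "M v \<subseteq> K"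
  by (auto simp: M_def)

lemma finite_W: "finite W"
  using finite_V by (simp add: W_def)

lemma card_W: "card W \<le> card V - (r - 2)"
proof -
  have "card W \<le> card (V - K)"
    by (rule card_mono) (auto simp: W_def finite_V)
  then show ?thesis
    using K finite_K by (simp add: card_Diff_subset)
qed

text \<open>Source of all Hall-type inequalities: extending \<open>C\<close> by its common
  neighbours in \<open>K\<close> turns the absence of cliques on \<open>r\<close> vertices in
  \<open>V\<close>, and on \<open>r - 1\<close> vertices in \<open>S\<close>, into bounds of
  \<open>card C\<close> by the number of vertices of \<open>K\<close> missed by
  \<open>C\<close>.\<close>

lemma clique_extends_to_root:
  assumes C: "C \<subseteq> V - K" "clique C E"
  shows "clique (C \<union> (K - \<Union>(M ` C))) E" "card (C \<union> (K - \<Union>(M ` C))) + card (\<Union>(M ` C)) = card C + (r - 2)"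
proof -
  have sub: "\<Union>(M ` C) \<subseteq> K" using M_subset by blast
  show "clique (C \<union> (K - \<Union>(M ` C))) E"
    unfolding clique_def
  proof (intro ballI impI)
    fix v w assume vw: "v \<in> C \<union> (K - \<Union>(M ` C))" "w \<in> C \<union> (K - \<Union>(M ` C))" "v \<noteq> w"
    then consider "v \<in> C" "w \<in> C" | "v \<in> K" "w \<in> K" | "v \<in> C" "w \<in> K - \<Union>(M ` C)"
      | "w \<in> C" "v \<in> K - \<Union>(M ` C)"
      by blast
    then show "{v, w} \<in> E"
    proof cases
      case 3
      then have "w \<notin> M v" by blast
      with 3 show ?thesis by (simp add: M_def insert_commute)
    next
      case 4
      then have "v \<notin> M w" by blast
      with 4 show ?thesis by (simp add: M_def)
    qed (use C(2) K(2) vw(3) in \<open>auto simp: clique_def\<close>)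
  qed
  have finC: "finite C" using C finite_V finite_subset by blast
  have "card (C \<union> (K - \<Union>(M ` C))) = card C + card (K - \<Union>(M ` C))"
    using C finC finite_K by (intro card_Un_disjoint) auto
  also have "card (K - \<Union>(M ` C)) = card K - card (\<Union>(M ` C))"
    using sub finite_K finite_subset by (intro card_Diff_subset) auto
  finally show "card (C \<union> (K - \<Union>(M ` C))) + card (\<Union>(M ` C)) = card C + (r - 2)"
    using card_mono[OF finite_K sub] K by linarith
qed

lemma card_clique_le_M:
  assumes "C \<subseteq> V - K" "clique C E"
  shows "card C \<le> Suc (card (\<Union>(M ` C)))"
proof -
  have "C \<union> (K - \<Union>(M ` C)) \<subseteq> V" using assms K by blast
  then have "card (C \<union> (K - \<Union>(M ` C))) < r"
    using clique_extends_to_root(1)[OF assms] card_clique_less by blast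
  then show ?thesis
    using clique_extends_to_root(2)[OF assms] r by linarith
qed

lemma sat_clique_le_M:
  assumes S: "sat S" "K \<subseteq> S" and C: "C \<subseteq> S - K" "clique C E"
  shows "card C \<le> card (\<Union>(M ` C))"
proof -
  have CV: "C \<subseteq> V - K" using C sat_subset[OF S(1)] by blast
  have "C \<union> (K - \<Union>(M ` C)) \<subseteq> S" using assms by blast
  then have "card (C \<union> (K - \<Union>(M ` C))) < r - 1"
    using clique_extends_to_root(1)[OF CV C(2)] sat_card_clique_less[OF S(1)] by blast
  then show ?thesis
    using clique_extends_to_root(2)[OF CV C(2)] r by linarith
qed

lemma sat_subset_W:
  assumes "sat S" "K \<subseteq> S"
  shows "S - K \<subseteq> W"
proof
  fix v assume v: "v \<in> S - K"
  then have "card {v} \<le> card (\<Union>(M ` {v}))"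
    using sat_clique_le_M[OF assms, of "{v}"] by (simp add: clique_def)
  then show "v \<in> W"
    using v sat_subset[OF assms(1)] by (auto simp: W_def)
qed

lemma sat_not_adj:
  assumes "sat S" "K \<subseteq> S" "v \<in> S - K" "w \<in> S - K" "M v = {k}" "M w = {k}"
  shows "{v, w} \<notin> E"
proof
  assume E: "{v, w} \<in> E"
  then have "v \<noteq> w" using no_loop by fastforce
  moreover have "clique {v, w} E"
    using E by (auto simp: clique_def insert_commute)
  ultimately show False
    using sat_clique_le_M[OF assms(1,2), of "{v, w}"] assms by simp
qed

text \<open>Let \<open>C\<close> be the part outside \<open>K\<close> of the clique created by
  adding \<open>v\<close>, without \<open>v\<close> itself. The rest of that clique lies in
  \<open>K\<close> and avoids everything missed by \<open>C\<close> or \<open>v\<close>, so counting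
  shows that \<open>C\<close> and \<open>v\<close> together miss at most \<open>card C\<close>
  vertices of \<open>K\<close>. By Hall's condition \<open>C\<close> alone already misses that many;
  hence \<open>C\<close> is tight and covers \<open>M v\<close>.\<close>

lemma sat_dominates:
  assumes S: "sat S" "K \<subseteq> S" and v: "v \<in> W" "v \<notin> S"
  obtains C where "C \<subseteq> S - K" "clique C E" "C \<noteq> {}" "\<And>c. c \<in> C \<Longrightarrow> {c, v} \<in> E"
    "M v \<subseteq> \<Union>(M ` C)" "card (\<Union>(M ` C)) = card C"
proof -
  have vV: "v \<in> V" "v \<notin> K" "M v \<noteq> {}" using v by (auto simp: W_def)
  obtain D where D: "D \<subseteq> insert v S" "finite D" "card D = r - 1" "clique D E" "v \<in> D"
    using sat_insert_clique[OF S(1) vV(1) v(2)] .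
  define C where "C = D - insert v K"
  have C: "C \<subseteq> S - K" "clique C E" and adj: "\<And>c. c \<in> C \<Longrightarrow> {c, v} \<in> E"
    using D unfolding C_def clique_def by blast+
  let ?N = "\<Union>(M ` C)"
  have finN: "finite ?N" "finite (M v)"
    using finite_subset[OF _ finite_K] M_subset by (simp_all add: UN_subset_iff)
  have finC: "finite C" using D(2) by (simp add: C_def)
  have "D \<inter> K \<subseteq> K - (?N \<union> M v)"
  proof
    fix k assume k: "k \<in> D \<inter> K"
    have "k \<notin> M c" if "c \<in> D" "c \<notin> K" for c
    proof -
      have "k \<noteq> c" using that k by blast
      then show ?thesis using D(4) k that by (simp add: clique_def M_def)
    qed
    then show "k \<in> K - (?N \<union> M v)"
      using k D(5) vV(2) by (auto simp: C_def)
  qed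
  then have "card (D \<inter> K) \<le> card (K - (?N \<union> M v))"
    using finite_K by (intro card_mono) auto
  also have "\<dots> = card K - card (?N \<union> M v)"
    using finN M_subset by (intro card_Diff_subset) blast+
  finally have 1: "card (D \<inter> K) \<le> (r - 2) - card (?N \<union> M v)"
    using K by simp
  have "?N \<union> M v \<subseteq> K" using M_subset by blast
  then have 2: "card (?N \<union> M v) \<le> r - 2"
    using card_mono[OF finite_K] K(3) by metis
  have "D = insert v (C \<union> (D \<inter> K))" "v \<notin> C \<union> (D \<inter> K)" "C \<inter> (D \<inter> K) = {}"
    using D(5) vV(2) by (auto simp: C_def)
  then have "card D = Suc (card C + card (D \<inter> K))"
    using finC D(2) by (metis card_Un_disjoint card_insert_disjoint finite_Int finite_UnI)
  then have le: "card (?N \<union> M v) \<le> card C"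
    using 1 2 D(3) r by linarith
  have "card ?N \<le> card (?N \<union> M v)"
    using finN by (intro card_mono) auto
  moreover have "card C \<le> card ?N"
    by (rule sat_clique_le_M[OF S C])
  ultimately have eq: "card ?N = card C" "card ?N = card (?N \<union> M v)"
    using le by auto
  then have "?N = ?N \<union> M v"
    using finN by (intro card_subset_eq) auto
  then have sub: "M v \<subseteq> ?N" by blast
  have "C \<noteq> {}" using sub vV(3) by auto
  with C adj sub eq(1) show ?thesis using that by blast
qed

text \<open>A triangle whose vertices all miss only \<open>k\<close> would form a clique on
  \<open>r\<close> vertices with \<open>K - {k}\<close>.\<close>

lemma triangle_free_cls: "triangle_free_graph (cls {k}) E"
proof
  show "finite (cls {k})" using finite_W by (simp add: cls_def)
  show "triangle_free (cls {k}) E"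
    unfolding triangle_free_def
  proof (intro ballI notI)
    fix x y z assume xyz: "x \<in> cls {k}" "y \<in> cls {k}" "z \<in> cls {k}"
      "{x, y} \<in> E \<and> {y, z} \<in> E \<and> {x, z} \<in> E"
    then have ne: "x \<noteq> y" "y \<noteq> z" "x \<noteq> z" using no_loop by fastforce+
    have "clique {x, y, z} E" using xyz by (auto simp: clique_def insert_commute)
    moreover have "{x, y, z} \<subseteq> V - K" using xyz by (auto simp: cls_def W_def)
    ultimately have "card {x, y, z} \<le> Suc (card (\<Union>(M ` {x, y, z})))"
      using card_clique_le_M by blast
    moreover have "\<Union>(M ` {x, y, z}) = {k}" using xyz by (auto simp: cls_def)
    ultimately show False using ne by simp
  qed
qed

section \<open>Vertices adjacent to almost all of their class\<close>

text \<open>The dichotomy behind the upper bounds for \<open>t = r\<close> and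
  \<open>t = r + 1\<close>. Over all members of size \<open>t\<close> only boundedly many vertices
  are universal, so a member containing one has one free vertex less. A vertex that is not universal
  misses some \<open>u\<close> of its class outside \<open>S\<close>, and the clique blocking
  \<open>u\<close> then says something about the rest of \<open>S\<close>.\<close>

definition universal :: "'a set \<Rightarrow> 'a \<Rightarrow> bool" where
  "universal S w \<longleftrightarrow> w \<in> S - K \<and> (\<forall>u \<in> cls (M w) - S. {w, u} \<in> E)"

definition univs :: "nat \<Rightarrow> 'a set" where
  "univs t = {w. \<exists>S. sat S \<and> K \<subseteq> S \<and> card S = t \<and> universal S w}"

lemma univs_subset: "univs t \<subseteq> W"
  using sat_subset_W by (fastforce simp: univs_def universal_def)

lemma finite_univs: "finite (univs t)"
  using univs_subset finite_W finite_subset by blast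

text \<open>Within one class, a universal vertex sees all others except at most the \<open>t\<close>
  vertices of its member, so \<open>card_almost_clique\<close> applies. There are at most
  \<open>2 ^ (r - 2)\<close> classes.\<close>

lemma card_univs: "card (univs t) \<le> 2 ^ (r - 2) * ((r - 1) * t)"
proof -
  have "card (univs t) \<le> card (Pow K) * ((r - 1) * t)"
  proof (rule card_le_card_index_times)
    show "finite (Pow K)" using finite_K by simp
    show "univs t \<subseteq> (\<Union>A\<in>Pow K. univs t \<inter> cls A)"
      using univs_subset[of t] M_subset by (auto simp: cls_def)
    show "finite (univs t \<inter> cls A)" for A
      using finite_univs by simp
    show "card (univs t \<inter> cls A) \<le> (r - 1) * t" for A
    proof (rule card_almost_clique)
      show "univs t \<inter> cls A \<subseteq> V"
        by (auto simp: cls_def W_def)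
      fix u assume u: "u \<in> univs t \<inter> cls A"
      then obtain S where S: "sat S" "card S = t" "universal S u"
        by (auto simp: univs_def)
      moreover have "M u = A" using u by (simp add: cls_def)
      ultimately have "finite S \<and> card S \<le> t \<and> (\<forall>v\<in>univs t \<inter> cls A - S. {u, v} \<in> E)"
        using sat_finite[OF S(1)] by (simp add: universal_def)
      then show "\<exists>S. finite S \<and> card S \<le> t \<and> (\<forall>v\<in>univs t \<inter> cls A - S. {u, v} \<in> E)"
        by blast
    qed
  qed
  then show ?thesis
    using K(3) finite_K by (simp add: card_Pow)
qed

text \<open>The clique blocking a vertex \<open>u\<close> of the class of \<open>w\<close> that is
  not adjacent to \<open>w\<close> cannot contain \<open>w\<close>, yet it covers
  \<open>M u = M w\<close>.\<close>

lemma not_universal_tight_clique: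
  assumes S: "sat S" "K \<subseteq> S" and w: "w \<in> S - K" "\<not> universal S w"
  obtains C where "C \<subseteq> S - K - {w}" "clique C E" "C \<noteq> {}" "M w \<subseteq> \<Union>(M ` C)"
    "card (\<Union>(M ` C)) = card C"
proof -
  obtain u where u: "u \<in> W" "M u = M w" "u \<notin> S" "{w, u} \<notin> E"
    using w by (auto simp: universal_def cls_def)
  obtain C where C: "C \<subseteq> S - K" "clique C E" "C \<noteq> {}" "\<And>c. c \<in> C \<Longrightarrow> {c, u} \<in> E"
    "M u \<subseteq> \<Union>(M ` C)" "card (\<Union>(M ` C)) = card C"
    using sat_dominates[OF S u(1,3)] by metis
  moreover have "w \<notin> C" using C(4)[of w] u(4) by blast
  ultimately show ?thesis
    using that[of C] u(2) by auto
qed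

lemma tight_singleton:
  assumes "v \<in> W" "M v \<subseteq> \<Union>(M ` {w})" "card (\<Union>(M ` {w})) = card {w}"
  obtains k where "k \<in> K" "M v = {k}" "M w = {k}"
proof -
  obtain k where k: "M w = {k}"
    using assms(3) by (auto simp: card_1_singleton_iff)
  then have "M v = {k}" using assms by (auto simp: W_def)
  with k show ?thesis using that M_subset[of w] by auto
qed

text \<open>A clique blocking a vertex of \<open>cls {k}\<close> must meet \<open>T\<close>:
  otherwise it would be \<open>{z}\<close>, and a tight clique of one vertex covering
  \<open>{k}\<close> has type \<open>{k}\<close>, which vertices outside \<open>T\<close> do not
  have.\<close>

lemma max_indep_cls:
  assumes S: "sat S" "K \<subseteq> S" and T: "T \<subseteq> S - K" "T \<subseteq> cls {k}"
    and rest: "S - K - T \<subseteq> {z}" "\<And>w. w \<in> S - K - T \<Longrightarrow> M w \<noteq> {k}"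
  shows "max_indep (cls {k}) E T"
  unfolding max_indep_def
proof (intro conjI ballI)
  show "T \<subseteq> cls {k}" by fact
  show "{x, y} \<notin> E" if "x \<in> T" "y \<in> T" for x y
    using that T by (intro sat_not_adj[OF S, of _ _ k]) (auto simp: cls_def)
  fix v assume v: "v \<in> cls {k} - T"
  then have vW: "v \<in> W" "M v = {k}" by (auto simp: cls_def)
  then have "v \<notin> K" by (simp add: W_def)
  then have "v \<notin> S" using rest(2)[of v] v vW by blast
  then obtain C where C: "C \<subseteq> S - K" "C \<noteq> {}" "\<And>c. c \<in> C \<Longrightarrow> {c, v} \<in> E" "clique C E"
    "M v \<subseteq> \<Union>(M ` C)" "card (\<Union>(M ` C)) = card C"
    using sat_dominates[OF S vW(1)] by metis
  have "C \<inter> T \<noteq> {}"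
  proof
    assume "C \<inter> T = {}"
    then have "C \<subseteq> S - K - T" using C(1) by blast
    then have "C = {z}" "z \<in> S - K - T" using rest(1) C(2) by blast+
    then show False
      using tight_singleton[OF vW(1), of z] C(5,6) rest(2)[of z] vW(2) by auto
  qed
  then show "\<exists>s\<in>T. {v, s} \<in> E"
    using C(3) by (auto simp: insert_commute)
qed

lemma max_indep_cls_all:
  assumes "sat S" "K \<subseteq> S" "S - K \<subseteq> cls {k}"
  shows "max_indep (cls {k}) E (S - K)"
  by (rule max_indep_cls[OF assms(1,2) _ assms(3)]) auto

lemma card_root_diff: "K \<subseteq> S \<Longrightarrow> finite S \<Longrightarrow> card (S - K) = card S - (r - 2)"
  using K(3) finite_K by (simp add: card_Diff_subset)

lemma inj_on_diff_root: "inj_on (\<lambda>S. S - K) {S. K \<subseteq> S}"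
  by (auto simp: inj_on_def)

lemma card_sat_cls_le:
  "card {S. sat S \<and> K \<subseteq> S \<and> card S = t \<and> S - K \<subseteq> cls {k}}
    \<le> card {T. max_indep (cls {k}) E T \<and> card T = t - (r - 2)}"
proof (rule card_inj_on_le)
  show "inj_on (\<lambda>S. S - K) {S. sat S \<and> K \<subseteq> S \<and> card S = t \<and> S - K \<subseteq> cls {k}}"
    by (rule inj_on_subset[OF inj_on_diff_root]) auto
  show "(\<lambda>S. S - K) ` {S. sat S \<and> K \<subseteq> S \<and> card S = t \<and> S - K \<subseteq> cls {k}}
      \<subseteq> {T. max_indep (cls {k}) E T \<and> card T = t - (r - 2)}"
    using max_indep_cls_all card_root_diff sat_finite by auto
  interpret tf: triangle_free_graph "cls {k}" E by (rule triangle_free_cls)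
  show "finite {T. max_indep (cls {k}) E T \<and> card T = t - (r - 2)}" by simp
qed

lemma card_cls_le: "card (cls A) \<le> card W"
  using finite_W by (intro card_mono) (auto simp: cls_def)

lemma card_W_le: "card W \<le> card V"
  using card_W by linarith

section \<open>Counting the members that contain a fixed clique \<open>K\<close>\<close>

text \<open>A universal vertex leaves a single free vertex, so if every member has one, the count is
  bounded. Otherwise a single member \<open>S\<close> without universal vertices determines
  everything: its two vertices outside \<open>K\<close> have the same type \<open>{k}\<close>, and
  since all other vertices of \<open>W\<close> are blocked by cliques among these two, the whole of
  \<open>W\<close> is the class of \<open>{k}\<close>. The bound on maximal independent pairs then
  covers all members.\<close>

lemma card_sat_root_r:
  "2 * card {S. sat S \<and> K \<subseteq> S \<and> card S = r} \<le> card V - (r - 2) \<or>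
   card {S. sat S \<and> K \<subseteq> S \<and> card S = r} \<le> 2 ^ (r - 2) * ((r - 1) * r) * (r - 1) + 10"
  (is "2 * card ?G \<le> _ \<or> _")
proof (cases "\<exists>S\<in>?G. \<forall>w. \<not> universal S w")
  case False
  have "card ?G \<le> card (univs r) * (r - 1)"
  proof (rule card_le_card_index_times[OF finite_univs])
    let ?A = "\<lambda>w. {S. sat S \<and> insert w K \<subseteq> S \<and> card S = Suc (card (insert w K))}"
    show "?G \<subseteq> (\<Union>w\<in>univs r. ?A w)"
    proof
      fix S assume S: "S \<in> ?G"
      then obtain w where w: "universal S w" using False by blast
      then have "w \<in> univs r" "w \<in> S" "w \<notin> K"
        using S by (auto simp: univs_def universal_def)
      moreover from this have "S \<in> ?A w"
        using S K(3) finite_K r by auto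
      ultimately show "S \<in> (\<Union>w\<in>univs r. ?A w)" by blast
    qed
    show "card (?A w) \<le> r - 1" for w
      by (rule card_sat_extensions)
  qed auto
  also have "\<dots> \<le> 2 ^ (r - 2) * ((r - 1) * r) * (r - 1)"
    using card_univs by (rule mult_le_mono1)
  finally show ?thesis by simp
next
  case True
  then obtain S where S: "sat S" "K \<subseteq> S" "card S = r" and nu: "\<And>w. \<not> universal S w"
    by blast
  have "card (S - K) = 2"
    using card_root_diff[OF S(2)] sat_finite[OF S(1)] S(3) r by simp
  then obtain x y where xy: "S - K = {x, y}" "x \<noteq> y"
    by (auto simp: card_2_iff)
  obtain C where C: "C \<subseteq> S - K - {x}" "C \<noteq> {}" "M x \<subseteq> \<Union>(M ` C)" "card (\<Union>(M ` C)) = card C"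
    using not_universal_tight_clique[OF S(1,2) _ nu, of x] xy(1) by (metis insertI1)
  then have "C = {y}" using xy by auto
  then obtain k where k: "k \<in> K" "M x = {k}" "M y = {k}"
    using C tight_singleton[of x y] sat_subset_W[OF S(1,2)] xy by auto
  have Wk: "W = cls {k}"
  proof (intro equalityI subsetI)
    fix v assume v: "v \<in> W"
    have "M v = {k}"
    proof (cases "v \<in> S")
      case True
      then have "v \<in> {x, y}" using v xy(1) by (auto simp: W_def)
      then show ?thesis using k by auto
    next
      case False
      then obtain C where C: "C \<subseteq> S - K" "M v \<subseteq> \<Union>(M ` C)"
        using sat_dominates[OF S(1,2) v] by metis
      have "M c = {k}" if "c \<in> C" for c
        using C(1) that k xy(1) by auto
      then have "M v \<subseteq> {k}" using C(2) by blast
      then show ?thesis using v by (auto simp: W_def)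
    qed
    then show "v \<in> cls {k}" using v by (simp add: cls_def)
  qed (simp add: cls_def)
  have eq: "?G = {S. sat S \<and> K \<subseteq> S \<and> card S = r \<and> S - K \<subseteq> cls {k}}"
    using sat_subset_W[unfolded Wk] by blast
  have "card ?G \<le> card {T. max_indep (cls {k}) E T \<and> card T = 2}"
    unfolding eq using card_sat_cls_le[of r k] r by simp
  moreover interpret tf: triangle_free_graph "cls {k}" E by (rule triangle_free_cls)
  have "2 * card {T. max_indep (cls {k}) E T \<and> card T = 2} \<le> card V - (r - 2) \<or>
      card {T. max_indep (cls {k}) E T \<and> card T = 2} \<le> 10"
    using tf.card_max_indep_pairs card_W unfolding Wk by linarith
  ultimately show ?thesis by linarith
qed

text \<open>If no two of the three vertices have the same singleton type, the tight clique belonging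
  to each of them must consist of both others. Then all three are pairwise adjacent, but together
  they miss no more than two of them do, namely two vertices of \<open>K\<close>, against Hall's
  condition.\<close>

lemma not_universal_equal_types:
  assumes S: "sat S" "K \<subseteq> S" "card (S - K) = 3" and nu: "\<And>w. \<not> universal S w"
  obtains x y z k where "S - K = {x, y, z}" "x \<noteq> y" "y \<noteq> z" "x \<noteq> z" "k \<in> K" "M x = {k}" "M y = {k}"
proof -
  have "\<exists>k\<in>K. \<exists>x\<in>S - K. \<exists>y\<in>S - K. x \<noteq> y \<and> M x = {k} \<and> M y = {k}"
  proof (rule ccontr)
    assume neg: "\<not> ?thesis"
    have tight: "clique (S - K - {w}) E \<and> M w \<subseteq> \<Union>(M ` (S - K - {w})) \<and>
        card (\<Union>(M ` (S - K - {w}))) = 2" if w: "w \<in> S - K" for w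
    proof -
      obtain C where C: "C \<subseteq> S - K - {w}" "clique C E" "C \<noteq> {}" "M w \<subseteq> \<Union>(M ` C)"
        "card (\<Union>(M ` C)) = card C"
        using not_universal_tight_clique[OF S(1,2) w nu] by metis
      have fin: "finite (S - K)" using sat_finite[OF S(1)] by simp
      have c2: "card (S - K - {w}) = 2" using S(3) w by simp
      have "C = S - K - {w}"
      proof (rule ccontr)
        assume "C \<noteq> S - K - {w}"
        then have "card C < 2"
          using psubset_card_mono[of "S - K - {w}" C] C(1) fin c2 by auto
        moreover have "card C \<noteq> 0" using C(1,3) fin by (auto dest: finite_subset)
        ultimately have "card C = 1" by linarith
        then obtain w' where w': "C = {w'}" by (auto simp: card_1_singleton_iff)
        have "w \<in> W" using sat_subset_W[OF S(1,2)] w by blast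
        then obtain k where "k \<in> K" "M w = {k}" "M w' = {k}"
          using tight_singleton[of w w'] C(4,5) unfolding w' by metis
        moreover have "w' \<in> S - K" "w \<noteq> w'" using w' C(1) by auto
        ultimately show False using neg w by blast
      qed
      then show ?thesis using C c2 by simp
    qed
    obtain x y z where xyz: "S - K = {x, y, z}" "x \<noteq> y" "y \<noteq> z" "x \<noteq> z"
      using S(3) unfolding card_3_iff by blast
    then have eqs: "S - K - {x} = {y, z}" "S - K - {y} = {x, z}" "S - K - {z} = {x, y}" by auto
    have "clique {y, z} E" "clique {x, z} E" "clique {x, y} E"
      using tight[of x] tight[of y] tight[of z] eqs xyz(1) by auto
    then have "clique {x, y, z} E" using xyz by (auto simp: clique_def)
    then have "card {x, y, z} \<le> card (\<Union>(M ` {x, y, z}))"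
      using sat_clique_le_M[OF S(1,2)] xyz(1) by blast
    moreover have "M x \<subseteq> \<Union>(M ` {y, z})" "card (\<Union>(M ` {y, z})) = 2"
      using tight[of x] eqs(1) xyz(1) by auto
    moreover from this have "\<Union>(M ` {x, y, z}) = \<Union>(M ` {y, z})" by auto
    ultimately show False using xyz by simp
  qed
  then obtain k x y where kxy: "k \<in> K" "x \<in> S - K" "y \<in> S - K" "x \<noteq> y" "M x = {k}" "M y = {k}"
    by blast
  then have "card (S - K - {x, y}) = 1"
    using S(3) sat_finite[OF S(1)] by (simp add: card_Diff_subset)
  then obtain z where z: "S - K - {x, y} = {z}" by (auto simp: card_1_singleton_iff)
  have "S - K = {x, y, z}" "z \<noteq> x" "z \<noteq> y" using z kxy by auto
  with kxy show ?thesis using that[of x y z k] by auto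
qed

text \<open>Members with a universal vertex have two free vertices, the second of which has at most
  \<open>r - 1\<close> choices. In the others, two vertices have type \<open>{k}\<close>. If the
  third has it as well, they form one of at most \<open>8 * card V\<close> maximal independent
  triples; if not, the two form one of at most \<open>2 * card V\<close> maximal independent pairs,
  and the third is again a completion.\<close>

lemma card_sat_root_Suc_r:
  "card {S. sat S \<and> K \<subseteq> S \<and> card S = r + 1}
    \<le> (2 ^ (r - 2) * ((r - 1) * (r + 1)) * (r - 1) + (r - 2) * (8 + 2 * (r - 1))) * card V"
  (is "card ?G \<le> _")
proof -
  let ?U = "{S \<in> ?G. \<exists>w. universal S w}"
  let ?N = "{S \<in> ?G. \<forall>w. \<not> universal S w}"
  have U: "card ?U \<le> card (univs (r + 1)) * (card V * (r - 1))"
  proof (rule card_le_card_index_times[OF finite_univs])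
    let ?A = "\<lambda>w. {S. sat S \<and> insert w K \<subseteq> S \<and> card S = card (insert w K) + 2}"
    show "?U \<subseteq> (\<Union>w\<in>univs (r + 1). ?A w)"
    proof
      fix S assume S: "S \<in> ?U"
      then obtain w where w: "universal S w" by blast
      then have "w \<in> univs (r + 1)" "w \<in> S" "w \<notin> K"
        using S by (auto simp: univs_def universal_def)
      moreover from this have "S \<in> ?A w"
        using S K(3) finite_K r by auto
      ultimately show "S \<in> (\<Union>w\<in>univs (r + 1). ?A w)" by blast
    qed
    show "card (?A w) \<le> card V * (r - 1)" for w
      using finite_K by (intro card_sat_extensions2) simp
  qed auto
  have N: "card ?N \<le> card K * (8 * card V + 2 * card V * (r - 1))"
  proof (rule card_le_card_index_times[OF finite_K])
    let ?P = "\<lambda>k. {T. max_indep (cls {k}) E T \<and> card T = 2 \<and> T \<inter> K = {}}"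
    let ?X = "\<lambda>k. {S. sat S \<and> K \<subseteq> S \<and> card S = r + 1 \<and> S - K \<subseteq> cls {k}}"
    let ?Y = "\<lambda>k. \<Union>T\<in>?P k. {S. sat S \<and> K \<union> T \<subseteq> S \<and> card S = Suc (card (K \<union> T))}"
    have finP: "finite (?P k)" for k
    proof -
      interpret tf: triangle_free_graph "cls {k}" E by (rule triangle_free_cls)
      show ?thesis by simp
    qed
    show "?N \<subseteq> (\<Union>k\<in>K. ?X k \<union> ?Y k)"
    proof
      fix S assume "S \<in> ?N"
      then have S: "sat S" "K \<subseteq> S" "card S = r + 1" and nu: "\<And>w. \<not> universal S w" by auto
      have "card (S - K) = 3"
        using card_root_diff[OF S(2)] sat_finite[OF S(1)] S(3) r by simp
      then obtain x y z k where xyz: "S - K = {x, y, z}" "x \<noteq> y" "y \<noteq> z" "x \<noteq> z"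
        and k: "k \<in> K" "M x = {k}" "M y = {k}"
        using not_universal_equal_types[OF S(1,2) _ nu] by metis
      have inW: "x \<in> W" "y \<in> W" "z \<in> W" and nK: "x \<notin> K" "y \<notin> K"
        using sat_subset_W[OF S(1,2)] xyz(1) by auto
      show "S \<in> (\<Union>k\<in>K. ?X k \<union> ?Y k)"
      proof (cases "M z = {k}")
        case True
        then have "S - K \<subseteq> cls {k}" using k inW xyz(1) by (auto simp: cls_def)
        then show ?thesis using S k(1) by blast
      next
        case False
        have "max_indep (cls {k}) E {x, y}"
          by (rule max_indep_cls[OF S(1,2), of _ k z])
             (use False k inW xyz in \<open>auto simp: cls_def\<close>)
        moreover have "card {x, y} = 2" using xyz by simp
        ultimately have P: "{x, y} \<in> ?P k" using nK by simp
        have "K \<union> {x, y} \<subseteq> S" using S(2) xyz(1) by blast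
        moreover have "card (K \<union> {x, y}) = r"
          using nK xyz(2) finite_K K(3) r by simp
        ultimately have "S \<in> ?Y k" using P S by auto
        then show ?thesis using k(1) by blast
      qed
    qed
    show "finite (?X k \<union> ?Y k)" for k
      using finP by auto
    show "card (?X k \<union> ?Y k) \<le> 8 * card V + 2 * card V * (r - 1)" for k
    proof -
      interpret tf: triangle_free_graph "cls {k}" E by (rule triangle_free_cls)
      have cV: "card (cls {k}) \<le> card V" using card_cls_le card_W_le order.trans by blast
      have "card (?X k) \<le> card (cls {k}) ^ 1 * 8"
        using card_sat_cls_le[of "r + 1" k] tf.card_max_indep_le[of 3] r by simp
      also have "\<dots> \<le> 8 * card V" using cV by simp
      finally have X: "card (?X k) \<le> 8 * card V" .
      have "card (?Y k) \<le> card (?P k) * (r - 1)"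
        by (rule card_le_card_index_times[OF finP subset_refl]) (rule finite_sat card_sat_extensions)+
      also have "card (?P k) \<le> card {T. max_indep (cls {k}) E T \<and> card T = 2}"
        by (intro card_mono) auto
      also have "\<dots> \<le> 2 * card V"
        using tf.card_max_indep_pairs_le cV by linarith
      finally have Y: "card (?Y k) \<le> 2 * card V * (r - 1)" by simp
      show ?thesis
        using card_Un_le[of "?X k" "?Y k"] X Y by linarith
    qed
  qed
  have "card ?G = card (?U \<union> ?N)"
    by (rule arg_cong[where f = card]) blast
  also have "\<dots> \<le> card ?U + card ?N"
    by (rule card_Un_le)
  also have "\<dots> \<le> 2 ^ (r - 2) * ((r - 1) * (r + 1)) * (card V * (r - 1)) +
      (r - 2) * (8 * card V + 2 * card V * (r - 1))"
    by (rule add_mono[OF order.trans[OF U mult_le_mono1[OF card_univs]] N[unfolded K(3)]])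
  also have "\<dots> = (2 ^ (r - 2) * ((r - 1) * (r + 1)) * (r - 1) + (r - 2) * (8 + 2 * (r - 1))) * card V"
    by (simp add: algebra_simps)
  finally show ?thesis .
qed

lemma card_sat_root_le_power:
  "card {S. sat S \<and> K \<subseteq> S \<and> card S = t} \<le> card V ^ (t - (r - 2))"
proof -
  have "card {S. sat S \<and> K \<subseteq> S \<and> card S = t} \<le> card ([V]\<^bsup>(t - (r - 2))\<^esup>)"
  proof (rule card_inj_on_le)
    show "inj_on (\<lambda>S. S - K) {S. sat S \<and> K \<subseteq> S \<and> card S = t}"
      by (rule inj_on_subset[OF inj_on_diff_root]) auto
    show "(\<lambda>S. S - K) ` {S. sat S \<and> K \<subseteq> S \<and> card S = t} \<subseteq> [V]\<^bsup>(t - (r - 2))\<^esup>"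
      using card_root_diff sat_finite sat_subset by (fastforce simp: nsets_def)
    show "finite ([V]\<^bsup>(t - (r - 2))\<^esup>)"
      using finite_V by (rule finite_imp_finite_nsets)
  qed
  then show ?thesis
    using card_nsets_le_power[OF finite_V] order.trans by blast
qed

text \<open>Since \<open>K\<close> is a single vertex, only one nonempty type exists, so members
  correspond to maximal independent \<open>(t - 1)\<close>-sets of one triangle-free graph. This
  saves two in the exponent \<open>t - 1\<close>.\<close>

lemma card_sat_root_3:
  assumes "r = 3" "t \<ge> 4"
  shows "card {S. sat S \<and> K \<subseteq> S \<and> card S = t} \<le> 8 * card V ^ (t - 3)"
proof -
  obtain k where Kk: "K = {k}"
    using K(3) assms(1) by (auto simp: card_1_singleton_iff)
  interpret tf: triangle_free_graph "cls {k}" E by (rule triangle_free_cls)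
  have "W \<subseteq> cls {k}"
  proof
    fix v assume "v \<in> W"
    moreover from this have "M v \<noteq> {}" by (simp add: W_def)
    then have "M v = {k}"
      using subset_trans[OF M_subset equalityD1[OF Kk], of v] by blast
    ultimately show "v \<in> cls {k}" by (simp add: cls_def)
  qed
  then have eq: "{S. sat S \<and> K \<subseteq> S \<and> card S = t} =
      {S. sat S \<and> K \<subseteq> S \<and> card S = t \<and> S - K \<subseteq> cls {k}}"
    using sat_subset_W by blast
  have "t - (r - 2) = t - 1" "3 \<le> t - 1" using assms by simp_all
  then have "card {S. sat S \<and> K \<subseteq> S \<and> card S = t} \<le> card (cls {k}) ^ (t - 1 - 2) * 8"
    unfolding eq using card_sat_cls_le[of t k] by (intro order.trans[OF _ tf.card_max_indep_le]) simp_all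
  also have "\<dots> \<le> card V ^ (t - 1 - 2) * 8"
    using order.trans[OF card_cls_le card_W_le] by (intro mult_le_mono1 power_mono) auto
  finally show ?thesis by (simp add: mult.commute numeral_3_eq_3)
qed

end

section \<open>Upper bounds\<close>

locale rt_family = clique_free_graph +
  fixes t :: nat and F :: "'a set set"
  assumes F_sat: "\<And>S. S \<in> F \<Longrightarrow> sat S" and F_card: "\<And>S. S \<in> F \<Longrightarrow> card S = t"
    and F_meet: "\<And>S T. S \<in> F \<Longrightarrow> T \<in> F \<Longrightarrow> S \<noteq> T \<Longrightarrow> contains_K (r - 2) (S \<inter> T) E"
begin

lemma finite_F: "finite F"
  by (rule finite_subset[of _ "Pow V"]) (use F_sat sat_subset finite_V in auto)

lemma meet_root:
  assumes "S \<in> F" "T \<in> F" "S \<noteq> T"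
  obtains K where "K \<subseteq> S" "K \<subseteq> T" "card K = r - 2" "clique K E"
  using F_meet[OF assms] unfolding contains_K_iff by auto

lemma rooted:
  assumes "S \<in> F" "K \<subseteq> S" "clique K E" "card K = r - 2"
  shows "rooted_graph V E r K"
  using assms F_sat sat_subset by unfold_locales blast+

lemma card_F_le:
  assumes B: "\<And>K. rooted_graph V E r K \<Longrightarrow> card {S. sat S \<and> K \<subseteq> S \<and> card S = t} \<le> B"
  shows "card F \<le> 2 ^ t * B + 1"
proof (cases "F = {}")
  case False
  then obtain S0 where S0: "S0 \<in> F" by blast
  let ?I = "{K \<in> Pow S0. clique K E \<and> card K = r - 2}"
  have finS0: "finite S0" using sat_finite F_sat S0 by blast
  have "card (F - {S0}) \<le> card ?I * B"
  proof (rule card_le_card_index_times)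
    show "F - {S0} \<subseteq> (\<Union>K\<in>?I. {S. sat S \<and> K \<subseteq> S \<and> card S = t})"
    proof
      fix S assume S: "S \<in> F - {S0}"
      then obtain K where "K \<subseteq> S" "K \<subseteq> S0" "card K = r - 2" "clique K E"
        using meet_root[of S S0] S0 by blast
      moreover have "sat S" "card S = t" using S F_sat F_card by auto
      ultimately show "S \<in> (\<Union>K\<in>?I. {S. sat S \<and> K \<subseteq> S \<and> card S = t})" by blast
    qed
    show "card {S. sat S \<and> K \<subseteq> S \<and> card S = t} \<le> B" if "K \<in> ?I" for K
      using that B rooted[OF S0] by blast
  qed (use finS0 in auto)
  also have "card ?I \<le> card (Pow S0)"
    using finS0 by (intro card_mono) auto
  also have "\<dots> = 2 ^ t"
    using finS0 F_card[OF S0] by (simp add: card_Pow)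
  finally have "card (F - {S0}) \<le> 2 ^ t * B" by simp
  then show ?thesis
    using card_Diff_singleton[OF S0] by linarith
qed simp

section \<open>The exact upper bounds for \<open>t \<le> r\<close>\<close>

lemma card_F_le_1:
  assumes "t = r - 2"
  shows "card F \<le> 1"
proof -
  have "S = T" if ST: "S \<in> F" "T \<in> F" for S T
  proof (rule ccontr)
    assume "S \<noteq> T"
    then obtain K where K: "K \<subseteq> S" "K \<subseteq> T" "card K = r - 2"
      using meet_root ST by metis
    have "K = S" "K = T"
      using card_subset_eq[OF sat_finite K(1)] card_subset_eq[OF sat_finite K(2)]
        ST F_sat F_card K(3) assms by metis+
    with \<open>S \<noteq> T\<close> show False by simp
  qed
  then show ?thesis
    using finite_F by (simp add: card_le_Suc0_iff_eq)
qed

text \<open>Two members are \<open>insert x K\<close> and \<open>insert y K\<close> with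
  \<open>x\<close>, \<open>y\<close> adjacent and missing the same single \<open>k\<close>. A third
  member containing \<open>K\<close> gives a triangle in the class of \<open>{k}\<close>. A third
  member \<open>U\<close> not containing \<open>K\<close> must share \<open>x\<close> with the first
  and \<open>y\<close> with the second; as \<open>x\<close> misses \<open>k\<close>, it also
  contains \<open>K - {k}\<close>, and together these form a clique on \<open>r - 1\<close> vertices
  in \<open>U\<close>.\<close>

lemma card_F_le_2:
  assumes t: "t = r - 1"
  shows "card F \<le> 2"
proof (rule ccontr)
  assume "\<not> card F \<le> 2"
  then have "3 \<le> card F" by linarith
  then obtain D where D: "D \<subseteq> F" "card D = 3" by (rule obtain_subset_with_card_n)
  then obtain S T U where "D = {S, T, U}" "S \<noteq> T" "T \<noteq> U" "S \<noteq> U"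
    unfolding card_3_iff by blast
  with D have STU: "S \<in> F" "T \<in> F" "U \<in> F" "S \<noteq> T" "T \<noteq> U" "S \<noteq> U"
    by auto
  obtain K where KST: "K \<subseteq> S" "K \<subseteq> T" "card K = r - 2" "clique K E"
    using meet_root[OF STU(1,2,4)] .
  interpret rooted_graph V E r K by (rule rooted[OF STU(1) KST(1,4,3)])
  have one: "\<exists>x. X - K = {x}" if "X \<in> F" "K \<subseteq> X" for X
  proof -
    have "card (X - K) = 1"
      using card_root_diff[OF that(2) sat_finite[OF F_sat[OF that(1)]]] F_card[OF that(1)] t r by simp
    then show ?thesis by (simp add: card_1_singleton_iff)
  qed
  have adj: "{x, y} \<in> E \<and> (\<exists>k\<in>K. M x = {k} \<and> M y = {k})"
    if XY: "X \<in> F" "Y \<in> F" "K \<subseteq> X" "K \<subseteq> Y" "X \<noteq> Y" "X - K = {x}" "Y - K = {y}" for X Y x y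
  proof -
    have "y \<in> W" using sat_subset_W[OF F_sat[OF XY(2)] XY(4)] XY(7) by simp
    moreover have "X = insert x K" "Y = insert y K" "y \<notin> K"
      using XY(3,4,6,7) by auto
    then have "y \<notin> X" using XY(5) by auto
    ultimately obtain C where C: "C \<subseteq> X - K" "C \<noteq> {}" "\<And>c. c \<in> C \<Longrightarrow> {c, y} \<in> E"
      "M y \<subseteq> \<Union>(M ` C)" "card (\<Union>(M ` C)) = card C"
      using sat_dominates[OF F_sat[OF XY(1)] XY(3), of y] by metis
    then have "C \<subseteq> {x}" using XY(6) by simp
    then have "C = {x}" using C(2) by blast
    then show ?thesis
      using tight_singleton[OF \<open>y \<in> W\<close>, of x] C(3-5) by (metis insertI1)
  qed
  obtain x where x: "S - K = {x}" using one[OF STU(1) KST(1)] by (elim exE)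
  obtain y where y: "T - K = {y}" using one[OF STU(2) KST(2)] by (elim exE)
  obtain k where k: "k \<in> K" "M x = {k}" "M y = {k}" and xy: "{x, y} \<in> E"
    using adj[OF STU(1,2) KST(1,2) STU(4) x y] by blast
  have "x \<noteq> y" using xy no_loop by fastforce
  have nK: "x \<notin> K" "y \<notin> K" using x y by blast+
  have inW: "x \<in> W" "y \<in> W"
    using sat_subset_W[OF F_sat[OF STU(1)] KST(1)] sat_subset_W[OF F_sat[OF STU(2)] KST(2)] x y by simp_all
  show False
  proof (cases "K \<subseteq> U")
    case True
    obtain z where z: "U - K = {z}" using one[OF STU(3) True] by (elim exE)
    have "{x, z} \<in> E" "{y, z} \<in> E" "M z = {k}"
      using adj[OF STU(1,3) KST(1) True STU(6) x z] adj[OF STU(2,3) KST(2) True STU(5) y z] k by auto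
    moreover have "z \<in> W" using sat_subset_W[OF F_sat[OF STU(3)] True] z by simp
    moreover interpret tf: triangle_free_graph "cls {k}" E by (rule triangle_free_cls)
    have "{x, z} \<notin> E" if "{y, z} \<in> E" "M z = {k}" "z \<in> W"
      using tf.no_triangle[of x y z] that xy k inW by (simp add: cls_def)
    ultimately show False by blast
  next
    case False
    obtain K1 where K1: "K1 \<subseteq> S" "K1 \<subseteq> U" "card K1 = r - 2" "clique K1 E"
      using meet_root[OF STU(1,3,6)] .
    obtain K2 where K2: "K2 \<subseteq> T" "K2 \<subseteq> U" "card K2 = r - 2"
      using meet_root[OF STU(2,3,5)] .
    have "K1 \<noteq> K" "K2 \<noteq> K" using False K1 K2 by auto
    then have nsub: "\<not> K1 \<subseteq> K" "\<not> K2 \<subseteq> K"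
      using card_subset_eq[OF finite_K] K(3) K1(3) K2(3) by metis+
    moreover have "K1 \<subseteq> insert x K" "K2 \<subseteq> insert y K" using K1(1) K2(1) x y by auto
    ultimately have xK1: "x \<in> K1" and yU: "y \<in> U" using K2(2) by blast+
    have "k \<notin> K1"
    proof
      assume "k \<in> K1"
      then have "{k, x} \<in> E" using K1(4) xK1 nK k by (auto simp: clique_def)
      then show False using k by (auto simp: M_def)
    qed
    then have "K1 - {x} \<subseteq> K - {k}" using K1(1) x by auto
    moreover have "card (K1 - {x}) = card (K - {k})"
      using K1(3) K(3) xK1 k(1) by simp
    ultimately have eq: "K1 - {x} = K - {k}"
      using finite_K by (intro card_subset_eq) auto
    have "M ` {x, y} = {{k}}" using k by auto
    moreover have "{x, y} \<subseteq> V - K" using inW by (auto simp: W_def)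
    moreover have "clique {x, y} E" using xy by (auto simp: clique_def insert_commute)
    ultimately have cl: "clique ({x, y} \<union> (K - {k})) E" "card ({x, y} \<union> (K - {k})) + 1 = 2 + (r - 2)"
      using clique_extends_to_root[of "{x, y}"] \<open>x \<noteq> y\<close> by auto
    have "{x, y} \<union> (K - {k}) \<subseteq> U" using eq K1(2) xK1 yU by blast
    then have "card ({x, y} \<union> (K - {k})) < r - 1"
      using sat_card_clique_less[OF F_sat[OF STU(3)] _ cl(1)] by blast
    then show False using cl(2) r by linarith
  qed
qed

lemma card_F_le_half:
  assumes t: "t = r"
  shows "2 * card F \<le> card V - (r - 2) \<or>
    card F \<le> 2 ^ (r - 2) * ((r - 1) * r) * (r - 1) + 10 + 2 ^ r * (r * (r - 1)) + 1"
proof (cases "\<exists>K. rooted_graph V E r K \<and> (\<forall>S\<in>F. K \<subseteq> S)")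
  case True
  then obtain K where K: "rooted_graph V E r K" "\<forall>S\<in>F. K \<subseteq> S" by blast
  have "card F \<le> card {S. sat S \<and> K \<subseteq> S \<and> card S = r}"
    using F_sat F_card K(2) t by (intro card_mono) auto
  then show ?thesis
    using rooted_graph.card_sat_root_r[OF K(1)] by linarith
next
  case False
  have "card F \<le> 2 ^ r * (r * (r - 1)) + 1"
  proof (cases "F = {}")
    case nonempty: False
    then obtain S0 where S0: "S0 \<in> F" by blast
    let ?I = "{K \<in> Pow S0. clique K E \<and> card K = r - 2}"
    have finS0: "finite S0" using sat_finite F_sat S0 by blast
    have "\<exists>S\<in>F. \<not> K \<subseteq> S" if "K \<in> ?I" for K
      using that False rooted[OF S0] by blast
    \<comment> \<open>For each \<open>K\<close> in \<open>S0\<close> fix a member \<open>g K\<close>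
      not containing it. A member \<open>S\<close> through \<open>K\<close> also meets
      \<open>g K\<close> in a clique on \<open>r - 2\<close> vertices, which is not \<open>K\<close>
      and so has a vertex \<open>e\<close> in \<open>g K - K\<close>. Thus \<open>S\<close> contains
      \<open>insert e K\<close> and is one of at most \<open>r - 1\<close> completions of
      it.\<close>
    then obtain g where g: "\<And>K. K \<in> ?I \<Longrightarrow> g K \<in> F \<and> \<not> K \<subseteq> g K" by metis
    let ?A = "\<lambda>K e. {S. sat S \<and> insert e K \<subseteq> S \<and> card S = Suc (card (insert e K))}"
    have "card (F - {S0}) \<le> card ?I * (r * (r - 1))"
    proof (rule card_le_card_index_times)
      show "F - {S0} \<subseteq> (\<Union>K\<in>?I. \<Union>e\<in>g K. ?A K e)"
      proof
        fix S assume S: "S \<in> F - {S0}"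
        then obtain K where K: "K \<subseteq> S" "K \<subseteq> S0" "card K = r - 2" "clique K E"
          using meet_root[of S S0] S0 by blast
        then have KI: "K \<in> ?I" by blast
        then have gK: "g K \<in> F" "\<not> K \<subseteq> g K" using g by auto
        then have "S \<noteq> g K" using K by blast
        then obtain K' where K': "K' \<subseteq> S" "K' \<subseteq> g K" "card K' = r - 2"
          using meet_root[OF _ gK(1)] S by (metis DiffD1)
        have finK: "finite K" using K(2) finS0 finite_subset by blast
        have "\<not> K' \<subseteq> K"
        proof
          assume "K' \<subseteq> K"
          then have "K' = K" using card_subset_eq[OF finK] K(3) K'(3) by metis
          then show False using K'(2) gK(2) by blast
        qed
        then obtain e where e: "e \<in> K'" "e \<notin> K" by blast
        have "sat S" "card S = r" using S F_sat F_card t by auto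
        then have "S \<in> ?A K e" using e K K'(1) finK r by auto
        moreover have "e \<in> g K" using e K' by blast
        ultimately show "S \<in> (\<Union>K\<in>?I. \<Union>e\<in>g K. ?A K e)" using KI by blast
      qed
      fix K assume KI: "K \<in> ?I"
      have gK: "finite (g K)" "card (g K) = r" using g[OF KI] F_sat sat_finite F_card t by auto
      then show "finite (\<Union>e\<in>g K. ?A K e)" by auto
      have "card (\<Union>e\<in>g K. ?A K e) \<le> card (g K) * (r - 1)"
        by (rule card_le_card_index_times[OF gK(1) subset_refl]) (rule finite_sat card_sat_extensions)+
      then show "card (\<Union>e\<in>g K. ?A K e) \<le> r * (r - 1)" using gK(2) by simp
    qed (use finS0 in auto)
    also have "card ?I \<le> card (Pow S0)"
      using finS0 by (intro card_mono) auto
    also have "\<dots> = 2 ^ r"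
      using finS0 F_card[OF S0] t by (simp add: card_Pow)
    finally have "card (F - {S0}) \<le> 2 ^ r * (r * (r - 1))" by simp
    then show ?thesis
      using card_Diff_singleton[OF S0] by linarith
  qed simp
  then show ?thesis by linarith
qed

end

lemma rt_system_rt_family:
  assumes "rt_system r t V E F" "r \<ge> 3"
  shows "rt_family V E r t (set_mset F)" "size F = card (set_mset F)"
proof -
  interpret clique_free_graph V E r
    using assms by unfold_locales (auto simp: rt_system_def r_system_def)
  show "rt_family V E r t (set_mset F)"
    using assms by unfold_locales (auto simp: rt_system_def r_system_def sat_def)
  show "size F = card (set_mset F)"
    using assms by (simp add: rt_system_def size_multiset_overloaded_eq)
qed

lemma s_le:
  assumes "r \<ge> 3" "\<And>(V :: nat set) E F. rt_family V E r t F \<Longrightarrow> card V = m \<Longrightarrow> card F \<le> B"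
  shows "s r t m \<le> B"
  unfolding s_def
proof (rule Max.boundedI[OF finite_system_sizes])
  show "system_sizes r t m \<noteq> {}"
    using assms(1) by (intro system_sizes_nonempty) simp
  fix n assume "n \<in> system_sizes r t m"
  then obtain V :: "nat set" and E F where F: "n = size F" "rt_system r t V E F" "card V = m"
    by (auto simp: system_sizes_def)
  then show "n \<le> B"
    using rt_system_rt_family[OF F(2) assms(1)] assms(2) by auto
qed

section \<open>Lower bounds\<close>

lemma s_ge:
  fixes V :: "nat set"
  assumes "rt_system r t V E (mset_set F)" "finite F" "card V = m"
  shows "card F \<le> s r t m"
proof -
  have "size (mset_set F) \<in> system_sizes r t m"
    unfolding system_sizes_def using assms by blast
  then show ?thesis
    unfolding s_def using Max_ge[OF finite_system_sizes] by force
qed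

text \<open>Adds to a triangle-free graph with relation \<open>R\<close> on \<open>W\<close> a clique \<open>{..<r - 2}\<close>, all of whose vertices
  but \<open>0\<close> are joined to everything; \<open>0\<close> is joined to the padding vertices \<open>{r - 2 + card W..<m}\<close> only.\<close>

lemma s_ge_max_indep:
  fixes R :: "'a \<Rightarrow> 'a \<Rightarrow> bool"
  assumes r: "r \<ge> 3" and finW: "finite W" and m: "card W + r - 2 \<le> m"
    and sym: "\<And>x y. R x y \<Longrightarrow> R y x"
    and tf: "\<And>x y z. \<lbrakk>x \<in> W; y \<in> W; z \<in> W; R x y; R y z; R x z\<rbrakk> \<Longrightarrow> False"
    and sub: "\<And>S. S \<in> \<S> \<Longrightarrow> S \<subseteq> W" and card: "\<And>S. S \<in> \<S> \<Longrightarrow> card S = k"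
    and ind: "\<And>S x y. \<lbrakk>S \<in> \<S>; x \<in> S; y \<in> S\<rbrakk> \<Longrightarrow> \<not> R x y"
    and dom: "\<And>S v. \<lbrakk>S \<in> \<S>; v \<in> W; v \<notin> S\<rbrakk> \<Longrightarrow> \<exists>x\<in>S. R v x"
  shows "card \<S> \<le> s r (k + r - 2) m"
proof -
  define n where "n = r - 2 + card W"
  have n: "n \<le> m" "r - 2 \<le> n" using m r by (auto simp: n_def)
  have "card W = card {r - 2..<n}" by (simp add: n_def)
  then obtain h where h: "bij_betw h W {r - 2..<n}"
    using finite_same_card_bij[OF finW] by blast
  define g where "g = inv_into W h"
  have gh: "g (h x) = x" if "x \<in> W" for x
    using h that by (simp add: g_def bij_betw_def)
  have hW: "h x \<in> {r - 2..<n}" if "x \<in> W" for x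
    using h that by (auto simp: bij_betw_def)
  have gW: "g u \<in> W" "h (g u) = u" if "u \<in> {r - 2..<n}" for u
    using h that unfolding g_def bij_betw_def
    by (auto intro: inv_into_into f_inv_into_f)
  define A where "A u v \<longleftrightarrow> u \<noteq> v \<and> (u < r - 2 \<and> v < r - 2 \<or> 0 < u \<and> u < r - 2 \<or> 0 < v \<and> v < r - 2 \<or>
      u = 0 \<and> n \<le> v \<or> v = 0 \<and> n \<le> u \<or>
      u \<in> {r - 2..<n} \<and> v \<in> {r - 2..<n} \<and> R (g u) (g v))" for u v
  have A_sym: "A u v \<Longrightarrow> A v u" for u v
    using sym by (auto simp: A_def)
  define E where "E = {e. \<exists>u v. e = {u, v} \<and> u < m \<and> v < m \<and> A u v}"
  have E_iff: "{u, v} \<in> E \<longleftrightarrow> u < m \<and> v < m \<and> A u v" for u v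
    unfolding E_def using A_sym by (auto simp: doubleton_eq_iff)
  let ?K = "{..<r - 2}"
  define F where "F = (\<lambda>S. ?K \<union> h ` S) ` \<S>"
  \<comment> \<open>Outside \<open>{0<..<r - 2}\<close> every edge either joins \<open>0\<close> to
    a padding vertex or lies in the copy of \<open>W\<close>. The former form a star that has no
    vertex in common with the latter.\<close>
  have no_triangle: False
    if "u \<notin> {0<..<r - 2}" "v \<notin> {0<..<r - 2}" "w \<notin> {0<..<r - 2}" "A u v" "A v w" "A u w" for u v w
  proof -
    have cls: "x = 0 \<and> n \<le> y \<or> y = 0 \<and> n \<le> x \<or> x \<in> {r - 2..<n} \<and> y \<in> {r - 2..<n} \<and> R (g x) (g y)"
      if "x \<notin> {0<..<r - 2}" "y \<notin> {0<..<r - 2}" "A x y" for x y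
      using that by (auto simp: A_def)
    have r0: "0 < r - 2" using r by simp
    have 1: "u = 0 \<and> n \<le> v \<or> v = 0 \<and> n \<le> u \<or> u \<in> {r - 2..<n} \<and> v \<in> {r - 2..<n} \<and> R (g u) (g v)"
      and 2: "v = 0 \<and> n \<le> w \<or> w = 0 \<and> n \<le> v \<or> v \<in> {r - 2..<n} \<and> w \<in> {r - 2..<n} \<and> R (g v) (g w)"
      and 3: "u = 0 \<and> n \<le> w \<or> w = 0 \<and> n \<le> u \<or> u \<in> {r - 2..<n} \<and> w \<in> {r - 2..<n} \<and> R (g u) (g w)"
      using cls that by blast+
    then have "u \<in> {r - 2..<n}" "v \<in> {r - 2..<n}" "w \<in> {r - 2..<n}"
      "R (g u) (g v)" "R (g v) (g w)" "R (g u) (g w)"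
      using r0 n by auto
    then show False using tf gW by blast
  qed
  \<comment> \<open>The vertices of \<open>{0<..<r - 2}\<close> account for at most
    \<open>r - 3\<close> vertices of a clique. So a clique on \<open>r\<close> vertices leaves a
    triangle, and one on \<open>r - 1\<close> vertices leaves an edge.\<close>
  have clique_split: "\<exists>D\<subseteq>C - {0<..<r - 2}. card D = j \<and> finite D"
    if "finite C" "card C \<ge> r - 3 + j" for C and j :: nat
  proof -
    have "card C - card {0<..<r - 2} \<le> card (C - {0<..<r - 2})"
      by (rule diff_card_le_card_Diff) simp
    then have "j \<le> card (C - {0<..<r - 2})" using that(2) by simp
    then show ?thesis using obtain_subset_with_card_n by metis
  qed
  have no_Kr: "\<not> contains_K r {..<m} E"
  proof
    assume "contains_K r {..<m} E"
    then obtain C where C: "C \<subseteq> {..<m}" "finite C" "card C = r" "clique C E"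
      unfolding contains_K_iff by blast
    then obtain D where D: "D \<subseteq> C - {0<..<r - 2}" "card D = 3"
      using clique_split[of C 3] r by auto
    then obtain u v w where uvw: "D = {u, v, w}" "u \<noteq> v" "v \<noteq> w" "u \<noteq> w"
      unfolding card_3_iff by blast
    then have "A u v" "A v w" "A u w"
      using C(4) D(1) E_iff by (auto simp: clique_def)
    then show False using no_triangle[of u v w] D(1) uvw(1) by auto
  qed
  have F_sub: "T \<subseteq> {..<m}" and F_card: "card T = k + r - 2"
    and F_free: "\<not> contains_K (r - 1) T E"
    and F_max: "\<And>v. v \<in> {..<m} - T \<Longrightarrow> contains_K (r - 1) (insert v T) E" if TF: "T \<in> F" for T
  proof -
    obtain S where S: "S \<in> \<S>" and T: "T = ?K \<union> h ` S" using TF by (auto simp: F_def)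
    have hS: "h x \<in> {r - 2..<n}" if "x \<in> S" for x using hW sub[OF S] that by blast
    have ghS: "g (h x) = x" if "x \<in> S" for x using gh sub[OF S] that by blast
    show "T \<subseteq> {..<m}" using hS n by (fastforce simp: T)
    have "inj_on h S" using h sub[OF S] by (auto simp: bij_betw_def intro: inj_on_subset)
    then have "card (h ` S) = k" using card[OF S] by (simp add: card_image)
    moreover have "finite S" using sub[OF S] finW finite_subset by blast
    moreover have "?K \<inter> h ` S = {}" using hS by fastforce
    ultimately show "card T = k + r - 2"
      unfolding T using r by (subst card_Un_disjoint) auto
    show "\<not> contains_K (r - 1) T E"
    proof
      assume "contains_K (r - 1) T E"
      then obtain C where C: "C \<subseteq> T" "finite C" "card C = r - 1" "clique C E"
        unfolding contains_K_iff by blast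
      then obtain D where D: "D \<subseteq> C - {0<..<r - 2}" "card D = 2"
        using clique_split[of C 2] r by force
      then obtain u v where uv: "D = {u, v}" "u \<noteq> v"
        unfolding card_2_iff by blast
      then have "A u v" using C(4) D(1) E_iff by (auto simp: clique_def)
      moreover have "u = 0 \<or> u \<in> h ` S" "v = 0 \<or> v \<in> h ` S"
        using D(1) uv(1) C(1) by (auto simp: T)
      moreover have "\<not> R (g (h x)) (g (h y))" if "x \<in> S" "y \<in> S" for x y
        using ind[OF S that] that by (simp add: ghS)
      ultimately show False
        using uv(2) hS r n by (fastforce simp: A_def)
    qed
    fix v assume v: "v \<in> {..<m} - T"
    then have vK: "r - 2 \<le> v" "v < m" by (auto simp: T)
    show "contains_K (r - 1) (insert v T) E"
    proof (cases "n \<le> v")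
      case True
      \<comment> \<open>A padding vertex is blocked by all of \<open>?K\<close>, which is why it is
        joined to \<open>0\<close>. A vertex of the copy of \<open>W\<close> misses
        \<open>0\<close>; below, its neighbour \<open>h x\<close> takes the place of
        \<open>0\<close>.\<close>
      have "clique (insert v ?K) E"
        using True n vK by (auto simp: clique_def E_iff A_def)
      then show ?thesis
        using vK r by (intro contains_K_if_clique[of "insert v ?K"]) (auto simp: T)
    next
      case False
      then have vn: "v \<in> {r - 2..<n}" using vK by simp
      have "h (g v) \<notin> h ` S" using v gW(2)[OF vn] by (simp add: T)
      then have "g v \<notin> S" by blast
      then obtain x where x: "x \<in> S" "R (g v) x" using dom[OF S gW(1)[OF vn]] by blast
      have hx: "h x \<in> {r - 2..<n}" "R (g v) (g (h x))" "h x \<in> T"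
        using hS[OF x(1)] x by (auto simp: T ghS)
      have "v \<noteq> h x" using v hx by blast
      have "clique (insert v (insert (h x) {0<..<r - 2})) E"
        using vn hx \<open>v \<noteq> h x\<close> n sym by (auto simp: clique_def E_iff A_def)
      moreover have "card (insert v (insert (h x) {0<..<r - 2})) = r - 1"
        using vn hx \<open>v \<noteq> h x\<close> r by simp
      moreover have "insert v (insert (h x) {0<..<r - 2}) \<subseteq> insert v T"
        using hx by (auto simp: T)
      ultimately show ?thesis
        by (intro contains_K_if_clique[of "insert v (insert (h x) {0<..<r - 2})"]) auto
    qed
  qed
  have K_clique: "clique ?K E" using n by (auto simp: clique_def E_iff A_def)
  have meet: "contains_K (r - 2) (S \<inter> T) E" if "S \<in> F" "T \<in> F" for S T
    using K_clique that by (intro contains_K_if_clique[of ?K]) (auto simp: F_def)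
  have finF: "finite F"
    by (rule finite_subset[of _ "Pow {..<m}"]) (use F_sub in auto)
  have "simple_graph {..<m} E"
    by (auto simp: simple_graph_def E_def nsets_def A_def card_insert_if)
  then have "rt_system r (k + r - 2) {..<m} E (mset_set F)"
    using no_Kr F_sub F_card F_free F_max meet finF
    by (auto simp: rt_system_def r_system_def maximally_K_free_def)
  then have "card F \<le> s r (k + r - 2) m"
    using finF by (intro s_ge) auto
  moreover have "card F = card \<S>"
    unfolding F_def
  proof (rule card_image, rule inj_onI)
    fix S T assume ST: "S \<in> \<S>" "T \<in> \<S>" "?K \<union> h ` S = ?K \<union> h ` T"
    have "h ` X = (?K \<union> h ` X) - ?K" if "X \<in> \<S>" for X
      using hW sub[OF that] by fastforce
    then have "h ` S = h ` T" using ST by metis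
    then show "S = T"
      using h sub ST(1,2) by (metis bij_betw_def inj_on_image_eq_iff)
  qed
  ultimately show ?thesis by simp
qed

section \<open>Explicit triangle-free graphs\<close>

lemma s_ge_1:
  assumes "r \<ge> 3" "m \<ge> r"
  shows "1 \<le> s r (r - 2) m"
proof -
  have "card {{} :: nat set} \<le> s r (0 + r - 2) m"
    by (rule s_ge_max_indep[where W = "{}" and R = "\<lambda>_ _. False"]) (use assms in auto)
  then show ?thesis by simp
qed

text \<open>In a single edge both endpoints are maximal independent sets.\<close>

lemma s_ge_2:
  assumes "r \<ge> 3" "m \<ge> r"
  shows "2 \<le> s r (r - 1) m"
proof -
  have "card {{True}, {False}} \<le> s r (1 + r - 2) m"
    by (rule s_ge_max_indep[where W = UNIV and R = "\<lambda>x y. x \<noteq> y"]) (use assms in \<open>auto simp: card_UNIV_bool\<close>)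
  moreover have "1 + r - 2 = r - 1" using assms by simp
  ultimately show ?thesis by simp
qed

text \<open>The crown graph: a complete bipartite graph with \<open>q\<close> vertices on each side,
  minus a perfect matching. The removed matching edges are disjoint maximal independent
  pairs.\<close>

lemma s_ge_crown:
  assumes "r \<ge> 3" "2 * q + r - 2 \<le> m"
  shows "q \<le> s r r m"
proof -
  let ?R = "\<lambda>(i :: nat, b :: bool) (j, c). i \<noteq> j \<and> b \<noteq> c"
  have "card ((\<lambda>i. {i} \<times> (UNIV :: bool set)) ` {..<q}) \<le> s r (2 + r - 2) m"
  proof (rule s_ge_max_indep[where W = "{..<q} \<times> UNIV" and R = ?R])
    show "card ({..<q} \<times> (UNIV :: bool set)) + r - 2 \<le> m"
      using assms by (simp add: card_cartesian_product card_UNIV_bool mult.commute)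
  qed (use assms in \<open>auto simp: card_cartesian_product card_UNIV_bool\<close>)
  moreover have "card ((\<lambda>i :: nat. {i} \<times> (UNIV :: bool set)) ` {..<q}) = q"
    by (subst card_image) (auto simp: inj_on_def)
  ultimately show ?thesis by simp
qed

text \<open>An isolated vertex, \<open>None\<close>, added to the crown graph belongs to every
  maximal independent set and raises all sizes by one.\<close>

lemma s_ge_crown_isolated:
  assumes "r \<ge> 3" "2 * q + r - 1 \<le> m"
  shows "q \<le> s r (r + 1) m"
proof -
  let ?R = "\<lambda>x y. \<exists>i j b c. x = Some (i :: nat, b :: bool) \<and> y = Some (j, c) \<and> i \<noteq> j \<and> b \<noteq> c"
  let ?S = "\<lambda>i. insert None (Some ` ({i} \<times> (UNIV :: bool set)))"
  have "card (?S ` {..<q}) \<le> s r (3 + r - 2) m"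
  proof (rule s_ge_max_indep[where W = "insert None (Some ` ({..<q} \<times> UNIV))" and R = ?R])
    show "card (insert None (Some ` ({..<q} \<times> (UNIV :: bool set)))) + r - 2 \<le> m"
      using assms by (simp add: card_image card_cartesian_product card_UNIV_bool)
    fix S assume "S \<in> ?S ` {..<q}"
    then obtain i where S: "S = ?S i" by auto
    show "card S = 3"
      unfolding S by (simp add: card_image card_cartesian_product card_UNIV_bool)
  qed (use assms in auto)
  moreover have "inj_on ?S {..<q}"
    by (auto simp: inj_on_def)
  then have "card (?S ` {..<q}) = q"
    by (simp add: card_image)
  moreover have "3 + r - 2 = r + 1" using assms by simp
  ultimately show ?thesis by simp
qed

text \<open>Blow up the cycle of length \<open>k\<close>: the vertices over \<open>i\<close> are pairs \<open>(a, b)\<close>, read as guesses for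
  \<open>(x i, x (i + 1))\<close>, and neighbouring guesses are joined iff they disagree. The maximal independent
  sets considered are the consistent ones, one for each \<open>x\<close>.\<close>

lemma s_ge_cycle:
  assumes "r \<ge> 3" and k: "k \<ge> 4" and m: "k * q\<^sup>2 + r - 2 \<le> m"
  shows "q ^ k \<le> s r (k + r - 2) m"
proof -
  define nx where "nx i = Suc i mod k" for i
  let ?W = "{..<k} \<times> {..<q} \<times> {..<q}"
  let ?R = "\<lambda>(i, a :: nat, b :: nat) (j, c, d). j = nx i \<and> b \<noteq> c \<or> i = nx j \<and> d \<noteq> a"
  let ?X = "{..<k} \<rightarrow>\<^sub>E {..<q}"
  let ?S = "\<lambda>x. (\<lambda>i. (i, x i, x (nx i))) ` {..<k}"
  have nx: "nx i = (if Suc i = k then 0 else Suc i)" if "i < k" for i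
    using that by (auto simp: nx_def)
  have nx_less: "nx i < k" for i using k by (simp add: nx_def)
  have nx_surj: "\<exists>j<k. nx j = i" if "i < k" for i
    using that k by (intro exI[of _ "if i = 0 then k - 1 else i - 1"]) (auto simp: nx)
  have "card (?S ` ?X) \<le> s r (k + r - 2) m"
  proof (rule s_ge_max_indep[where W = ?W and R = ?R])
    show "card ?W + r - 2 \<le> m"
      using m by (simp add: card_cartesian_product power2_eq_square)
    show "?R y x" if "?R x y" for x y
      using that by auto
    show False if xyz: "x \<in> ?W" "y \<in> ?W" "z \<in> ?W" "?R x y" "?R y z" "?R x z" for x y z
    proof -
      obtain i a b where x: "x = (i, a, b)" by (cases x)
      obtain j c d where y: "y = (j, c, d)" by (cases y)
      obtain l e f where z: "z = (l, e, f)" by (cases z)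
      have "i < k" "j < k" "l < k" "j = nx i \<or> i = nx j" "l = nx j \<or> j = nx l" "l = nx i \<or> i = nx l"
        using xyz x y z by auto
      then show False
        using k by (auto simp: nx split: if_splits)
    qed
    fix S assume "S \<in> ?S ` ?X"
    then obtain x where x: "x \<in> ?X" and S: "S = ?S x" by auto
    have xq: "x i < q" if "i < k" for i using x that by (auto simp: PiE_iff)
    show "S \<subseteq> ?W" using xq nx_less by (auto simp: S)
    show "card S = k"
      unfolding S by (subst card_image) (auto simp: inj_on_def)
    show "\<not> ?R v w" if "v \<in> S" "w \<in> S" for v w
      using that by (auto simp: S)
    show "\<exists>w\<in>S. ?R v w" if v: "v \<in> ?W" "v \<notin> S" for v
    proof -
      obtain i a b where v_eq: "v = (i, a, b)" by (cases v)
      then have i: "i < k" using v by auto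
      \<comment> \<open>A wrong second guess is contradicted by the vertex of \<open>S\<close> over
        the next position, a wrong first guess by the one over the previous position.\<close>
      have "a \<noteq> x i \<or> b \<noteq> x (nx i)" using v i by (auto simp: v_eq S)
      then show ?thesis
      proof
        assume "b \<noteq> x (nx i)"
        then show ?thesis
          using nx_less by (intro bexI[of _ "(nx i, x (nx i), x (nx (nx i)))"]) (auto simp: v_eq S)
      next
        assume a: "a \<noteq> x i"
        obtain j where "j < k" "nx j = i" using nx_surj[OF i] by blast
        then show ?thesis
          using a by (intro bexI[of _ "(j, x j, x (nx j))"]) (auto simp: v_eq S)
      qed
    qed
  qed (use assms in auto)
  moreover have "card (?S ` ?X) = q ^ k"
  proof -
    have "inj_on ?S ?X"
    proof (rule inj_onI)
      fix x y assume xy: "x \<in> ?X" "y \<in> ?X" "?S x = ?S y"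
      show "x = y"
      proof (rule PiE_ext[OF xy(1,2)])
        fix i assume "i \<in> {..<k}"
        then have "(i, x i, x (nx i)) \<in> ?S y" using xy(3) by blast
        then show "x i = y i" by auto
      qed
    qed
    then show ?thesis by (simp add: card_image card_PiE)
  qed
  ultimately show ?thesis by simp
qed

section \<open>Asymptotic bounds and conclusion\<close>

lemma s_lower_bigo:
  assumes r: "r \<ge> 3" and t: "t \<ge> r + 2"
  shows "(\<lambda>m. real m powr ((real t - real r + 2) / 2)) \<in> O(\<lambda>m. real (s r t m))"
proof -
  define k where "k = t - r + 2"
  have k: "k \<ge> 4" "k + r - 2 = t" and k_real: "real t - real r + 2 = real k"
    using t r by (auto simp: k_def of_nat_diff)
  \<comment> \<open>For the largest \<open>q\<close> with
    \<open>k * q\<^sup>2 \<le> m - (r - 2)\<close>, the 4 comes from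
    \<open>Suc q \<le> 2 * q\<close>, and the summand \<open>r\<close> absorbs the vertices of the
    added clique; both need \<open>q \<ge> 1\<close>, which \<open>m \<ge> k + r\<close>
    ensures.\<close>
  define c where "c = real (4 * k + r)"
  have "norm (real m powr (real k / 2)) \<le> c powr (real k / 2) * norm (real (s r t m))"
    if m: "m \<ge> k + r" for m
  proof -
    define q where "q = floor_sqrt ((m - (r - 2)) div k)"
    have k0: "0 < k" using k by simp
    have "q\<^sup>2 \<le> (m - (r - 2)) div k" by (simp add: q_def)
    then have "q\<^sup>2 * k \<le> m - (r - 2)" using k0 by (simp add: less_eq_div_iff_mult_less_eq)
    then have "k * q\<^sup>2 + r - 2 \<le> m" using m r by (simp add: mult.commute)
    then have s: "q ^ k \<le> s r t m"
      using s_ge_cycle[OF r k(1), of q m] k(2) by simp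
    have "(m - (r - 2)) div k < (Suc q)\<^sup>2"
      unfolding q_def by (rule Suc_floor_sqrt_power2_gt)
    then have "m - (r - 2) < (Suc q)\<^sup>2 * k"
      using k0 by (simp add: div_less_iff_less_mult)
    moreover have q1: "1 \<le> q"
    proof -
      have "1 \<le> (m - (r - 2)) div k" using m k0 r by (simp add: Suc_le_eq div_greater_zero_iff)
      then show ?thesis
        unfolding q_def by (simp add: le_floor_sqrt_iff)
    qed
    then have "(Suc q)\<^sup>2 \<le> (2 * q)\<^sup>2" by (intro power_mono) auto
    ultimately have "m - (r - 2) < (2 * q)\<^sup>2 * k"
      using mult_le_mono1[of "(Suc q)\<^sup>2" "(2 * q)\<^sup>2" k] by linarith
    then have "m \<le> 4 * k * q\<^sup>2 + r"
      using r by (simp add: power2_eq_square algebra_simps)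
    also have "\<dots> \<le> 4 * k * q\<^sup>2 + r * q\<^sup>2"
      using q1 by simp
    finally have "real m \<le> real ((4 * k + r) * q\<^sup>2)"
      unfolding of_nat_le_iff by (simp add: algebra_simps)
    then have "real m powr (real k / 2) \<le> (c * (real q)\<^sup>2) powr (real k / 2)"
      by (intro powr_mono2) (auto simp: c_def)
    also have "\<dots> = c powr (real k / 2) * ((real q)\<^sup>2) powr (real k / 2)"
      by (rule powr_mult)
    also have "(real q)\<^sup>2 = real q powr 2"
      using q1 by simp
    also have "(real q powr 2) powr (real k / 2) = real q powr real k"
      unfolding powr_powr by simp
    also have "\<dots> = real (q ^ k)"
      using q1 by (simp add: powr_realpow)
    also have "c powr (real k / 2) * real (q ^ k) \<le> c powr (real k / 2) * real (s r t m)"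
      using s by (intro mult_left_mono) auto
    finally show ?thesis by simp
  qed
  then show ?thesis
    unfolding k_real by (intro bigoI[where c = "c powr (real k / 2)"])
      (auto simp: eventually_sequentially)
qed

lemma s_bigo:
  assumes "\<And>m. s r t m \<le> A * m ^ n + 1"
  shows "(\<lambda>m. real (s r t m)) \<in> O(\<lambda>m. real m ^ n)"
proof (rule bigoI[where c = "real (A + 1)"])
  have "norm (real (s r t m)) \<le> real (A + 1) * norm (real m ^ n)" if "m \<ge> 1" for m
  proof -
    have "1 \<le> m ^ n" using that by simp
    then have "s r t m \<le> (A + 1) * m ^ n" using assms[of m] by (simp add: algebra_simps)
    then have "real (s r t m) \<le> real ((A + 1) * m ^ n)" by (simp only: of_nat_le_iff)
    then show ?thesis by (simp add: algebra_simps)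
  qed
  then show "\<forall>\<^sub>F m in sequentially. norm (real (s r t m)) \<le> real (A + 1) * norm (real m ^ n)"
    by (auto simp: eventually_sequentially)
qed

lemma s_le_rooted:
  assumes "r \<ge> 3"
    and "\<And>(V :: nat set) E K. rooted_graph V E r K \<Longrightarrow> card V = m \<Longrightarrow>
      card {S. clique_free_graph.sat V E r S \<and> K \<subseteq> S \<and> card S = t} \<le> B"
  shows "s r t m \<le> 2 ^ t * B + 1"
proof (rule s_le[OF assms(1)])
  fix V :: "nat set" and E F assume F: "rt_family V E r t F" "card V = m"
  show "card F \<le> 2 ^ t * B + 1"
    by (rule rt_family.card_F_le[OF F(1)]) (rule assms(2)[OF _ F(2)])
qed

theorem theorem11:
  shows "(\<forall>r\<ge>3. \<forall>\<^sub>F m in sequentially. s r (r - 2) m = 1) \<and>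
    (\<forall>r\<ge>3. \<forall>\<^sub>F m in sequentially. s r (r - 1) m = 2) \<and>
    (\<forall>r\<ge>3. \<forall>\<^sub>F m in sequentially.
       int (s r r m) = \<lfloor>(real m - real r + 2) / 2\<rfloor>) \<and>
    (\<forall>r\<ge>3. (\<lambda>m. real (s r (r + 1) m)) \<in> \<Theta>(\<lambda>m. real m)) \<and>
    (\<forall>r\<ge>3. \<forall>t\<ge>r + 2.
       (\<lambda>m. real m powr ((real t - real r + 2) / 2)) \<in> O(\<lambda>m. real (s r t m)) \<and>
       (\<lambda>m. real (s r t m)) \<in> O(\<lambda>m. real m ^ (t - r + 2))) \<and>
    (\<forall>t\<ge>5.
       (\<lambda>m. real m powr ((real t - 1) / 2)) \<in> O(\<lambda>m. real (s 3 t m)) \<and>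
       (\<lambda>m. real (s 3 t m)) \<in> O(\<lambda>m. real m ^ (t - 3)))"
proof (intro conjI allI impI)
  fix r :: nat assume r: "r \<ge> 3"
  show "\<forall>\<^sub>F m in sequentially. s r (r - 2) m = 1"
    unfolding eventually_sequentially
  proof (intro exI allI impI)
    fix m assume "r \<le> m"
    moreover have "s r (r - 2) m \<le> 1"
      by (intro s_le[OF r] rt_family.card_F_le_1) auto
    ultimately show "s r (r - 2) m = 1"
      using s_ge_1[OF r] by (intro antisym) auto
  qed
  show "\<forall>\<^sub>F m in sequentially. s r (r - 1) m = 2"
    unfolding eventually_sequentially
  proof (intro exI allI impI)
    fix m assume "r \<le> m"
    moreover have "s r (r - 1) m \<le> 2"
      by (intro s_le[OF r] rt_family.card_F_le_2) auto
    ultimately show "s r (r - 1) m = 2"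
      using s_ge_2[OF r] by (intro antisym) auto
  qed
  define c where "c = 2 ^ (r - 2) * ((r - 1) * r) * (r - 1) + 10 + 2 ^ r * (r * (r - 1)) + 1"
  show "\<forall>\<^sub>F m in sequentially. int (s r r m) = \<lfloor>(real m - real r + 2) / 2\<rfloor>"
    unfolding eventually_sequentially
  proof (intro exI allI impI)
    \<comment> \<open>This makes \<open>q > c\<close>, so both alternatives of
      \<open>card_F_le_half\<close> give \<open>card F \<le> q\<close>.\<close>
    fix m assume m: "2 * c + r \<le> m"
    define q where "q = (m - (r - 2)) div 2"
    have "card F \<le> q" if "rt_family V E r r F" "card V = m" for V :: "nat set" and E F
      using rt_family.card_F_le_half[OF that(1)] that(2) m unfolding c_def[symmetric] q_def by linarith
    then have "s r r m \<le> q" by (intro s_le[OF r])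
    moreover have "q \<le> s r r m"
      using m r by (intro s_ge_crown) (auto simp: q_def)
    ultimately have "int (s r r m) = int q" by simp
    also have "\<dots> = \<lfloor>real (m - (r - 2)) / real 2\<rfloor>"
      unfolding q_def by (rule floor_divide_of_nat_eq[symmetric])
    also have "real (m - (r - 2)) = real m - real r + 2"
      using m r by (simp add: of_nat_diff)
    finally show "int (s r r m) = \<lfloor>(real m - real r + 2) / 2\<rfloor>" by simp
  qed
  show "(\<lambda>m. real (s r (r + 1) m)) \<in> \<Theta>(\<lambda>m. real m)"
  proof (rule bigthetaI)
    define A where "A = 2 ^ (r - 2) * ((r - 1) * (r + 1)) * (r - 1) + (r - 2) * (8 + 2 * (r - 1))"
    have "s r (r + 1) m \<le> 2 ^ (r + 1) * (A * m) + 1" for m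
    proof (rule s_le_rooted[OF r])
      fix V :: "nat set" and E K assume "rooted_graph V E r K" "card V = m"
      then show "card {S. clique_free_graph.sat V E r S \<and> K \<subseteq> S \<and> card S = r + 1} \<le> A * m"
        using rooted_graph.card_sat_root_Suc_r[of V E r K] unfolding A_def by metis
    qed
    then have "s r (r + 1) m \<le> (2 ^ (r + 1) * A) * m ^ 1 + 1" for m
      by (simp add: mult.assoc)
    then have "(\<lambda>m. real (s r (r + 1) m)) \<in> O(\<lambda>m. real m ^ 1)"
      by (rule s_bigo)
    then show "(\<lambda>m. real (s r (r + 1) m)) \<in> O(\<lambda>m. real m)"
      by simp
    have "norm (real m) \<le> 4 * norm (real (s r (r + 1) m))" if "m \<ge> 4 * r" for m
    proof -
      define q where "q = (m - (r - 1)) div 2"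
      have "q \<le> s r (r + 1) m"
        using that r by (intro s_ge_crown_isolated) (auto simp: q_def)
      moreover have "m \<le> 4 * q" using that r unfolding q_def by linarith
      ultimately show ?thesis by simp
    qed
    then show "(\<lambda>m. real (s r (r + 1) m)) \<in> \<Omega>(\<lambda>m. real m)"
      unfolding bigomega_iff_bigo by (intro bigoI[where c = 4]) (auto simp: eventually_sequentially)
  qed
  fix t assume t: "t \<ge> r + 2"
  show "(\<lambda>m. real m powr ((real t - real r + 2) / 2)) \<in> O(\<lambda>m. real (s r t m))"
    by (rule s_lower_bigo[OF r t])
  have "t - (r - 2) = t - r + 2" using t r by simp
  then have "s r t m \<le> 2 ^ t * m ^ (t - r + 2) + 1" for m
    using rooted_graph.card_sat_root_le_power[of _ _ r _ t] by (intro s_le_rooted[OF r]) fastforce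
  then show "(\<lambda>m. real (s r t m)) \<in> O(\<lambda>m. real m ^ (t - r + 2))"
    by (rule s_bigo)
next
  fix t :: nat assume t: "t \<ge> 5"
  show "(\<lambda>m. real m powr ((real t - 1) / 2)) \<in> O(\<lambda>m. real (s 3 t m))"
    using s_lower_bigo[of 3 t] t by simp
  have "s 3 t m \<le> 2 ^ t * (8 * m ^ (t - 3)) + 1" for m
  proof (rule s_le_rooted)
    fix V :: "nat set" and E K assume "rooted_graph V E 3 K" "card V = m"
    then show "card {S. clique_free_graph.sat V E 3 S \<and> K \<subseteq> S \<and> card S = t} \<le> 8 * m ^ (t - 3)"
      using rooted_graph.card_sat_root_3[of V E 3 K t] t by simp
  qed simp
  then have "s 3 t m \<le> (2 ^ t * 8) * m ^ (t - 3) + 1" for m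
    by (simp add: mult.assoc)
  then show "(\<lambda>m. real (s 3 t m)) \<in> O(\<lambda>m. real m ^ (t - 3))"
    by (rule s_bigo)
qed

end
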